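(* Let $\lambda\ge 0$ and $a_\lambda\ge 0$ be some prespecified constants. Suppose that $(\bar{\mathbf{x}}_T-\bar{\mathbf{x}}_C)\,|\,\mathbf{x}\sim\mathcal{N}(0,\mathbf{\Sigma})$ and $N_T=N_C$. If $(\bar{\boldsymbol{\epsilon}}_T-\bar{\boldsymbol{\epsilon}}_C)$ is conditionally independent of $(\bar{\mathbf{x}}_T-\bar{\mathbf{x}}_C)$ given $\mathbf{x}$, and if there is an additive treatment effect, then $$\mathrm{Var}(\hat\tau\,|\,\mathbf{x})-\mathrm{Var}(\hat\tau\,|\,\mathbf{x},M_\lambda\le a_\lambda)=\boldsymbol{\beta}^\top\mathbf{\Gamma}\,\mathbf{Diag}\big((\lambda_k(1-d_{k,\lambda}))_{1\le k\le K}\big)\,\mathbf{\Gamma}^\top\boldsymbol{\beta},$$ so that $$\mathrm{Var}(\hat\tau\,|\,\mathbf{x},M_\lambda\le a_\lambda)\;\le\;\mathrm{Var}(\hat\tau\,|\,\mathbf{x}),$$ where the equality holds if and only if $\boldsymbol{\beta}=\mathbf{0}_K$.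
   Context: $\mathbf{x}$ is the real $N\times K$ matrix of $K$ covariates measured on $N$ experimental units, with $i$-th row $\mathbf{x}_{i\bullet}$. In a completely randomized experiment, a fixed number $N_T$ of units is assigned to treatment and $N_C=N-N_T$ to control; $W_i=1$ if unit $i$ is assigned to treatment and $W_i=0$ otherwise, and $\mathbf{W}=(W_1,\dots,W_N)^\top$ is the random assignment vector. The covariate mean vectors in treatment and control are $\bar{\mathbf{x}}_T=N_T^{-1}\mathbf{x}^\top\mathbf{W}$ and $\bar{\mathbf{x}}_C=N_C^{-1}\mathbf{x}^\top(\mathbf{1}_N-\mathbf{W})$, where $\mathbf{1}_N$ is the all-ones column vector. $\mathbf{\Sigma}=\mathrm{Cov}(\bar{\mathbf{x}}_T-\bar{\mathbf{x}}_C\,|\,\mathbf{x})=\frac{N}{N_TN_C}S^2_{\mathbf{x}}$ is the covariance matrix of the covariate mean differences under complete randomization, where $S^2_{\mathbf{x}}=(N-1)^{-1}(\mathbf{x}-\mathbf{1}_N\bar{\mathbf{x}}_N)^\top(\mathbf{x}-\mathbf{1}_N\bar{\mathbf{x}}_N)$ and $\bar{\mathbf{x}}_N=N^{-1}\mathbf{1}_N^\top\mathbf{x}$. $\mathbf{\Sigma}$ is assumed positive definite, with spectral decomposition $\mathbf{\Sigma}=\mathbf{\Gamma}\,\mathbf{Diag}(\lambda_1,\dots,\lambda_K)\,\mathbf{\Gamma}^\top$, where $\lambda_1\ge\dots\ge\lambda_K>0$ are the eigenvalues and $\mathbf{\Gamma}$ is the orthogonal matrix of corresponding eigenvectors; $\mathbf{Diag}$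 of a $K$-tuple is the diagonal matrix with those entries. Each unit $i$ has fixed potential outcomes $Y_i(1)$ (treatment) and $Y_i(0)$ (control), and the observed outcome is $y_i^{obs}=W_iY_i(1)+(1-W_i)Y_i(0)$. The average treatment effect is $\tau=N^{-1}\sum_{i=1}^N[Y_i(1)-Y_i(0)]$, and its mean-difference estimator is $\hat\tau=\bar{\mathbf{y}}_T-\bar{\mathbf{y}}_C$, where $\bar{\mathbf{y}}_T=N_T^{-1}\mathbf{W}^\top\mathbf{y}^{obs}$, $\bar{\mathbf{y}}_C=N_C^{-1}(\mathbf{1}_N-\mathbf{W})^\top\mathbf{y}^{obs}$ and $\mathbf{y}^{obs}=(y_1^{obs},\dots,y_N^{obs})^\top$. Additive treatment effect means $Y_i(1)=Y_i(0)+\tau$ for all $i$; then, without loss of generality, $Y_i(W_i)=\beta_0+\mathbf{x}_{i\bullet}\boldsymbol{\beta}+\tau W_i+\epsilon_i$ for all $i$, where $\beta_0+\mathbf{x}\boldsymbol{\beta}$ is the projection of $(Y_1(0),\dots,Y_N(0))^\top$ onto the linear space spanned by $(\mathbf{1},\mathbf{x})$ and $\epsilon_i\in\mathbb{R}$ captures any misspecification of the linear relationship between the outcomes and $\mathbf{x}$. With $\boldsymbol{\epsilon}=(\epsilon_1,\dots,\epsilon_N)^\top$, set $\bar{\boldsymbol{\epsilon}}_T=N_T^{-1}\mathbf{W}^\top\boldsymbol{\epsilon}$ and $\bar{\boldsymbol{\epsilon}}_C=N_C^{-1}(\mathbf{1}_N-\mathbf{W})^\top\boldsymbol{\epsilon}$.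 The ridge Mahalanobis distance is $M_\lambda=(\bar{\mathbf{x}}_T-\bar{\mathbf{x}}_C)^\top(\mathbf{\Sigma}+\lambda\,\mathbf{I}_K)^{-1}(\bar{\mathbf{x}}_T-\bar{\mathbf{x}}_C)$, with $\mathbf{I}_K$ the identity matrix. Ridge rerandomization draws $\mathbf{W}$ repeatedly and independently until $M_\lambda\le a_\lambda$, i.e. conditions on $M_\lambda\le a_\lambda$. For $k=1,\dots,K$, $d_{k,\lambda}=\mathbb{E}\big[Z_k^2\,\big|\,\sum_{j=1}^K\frac{\lambda_j}{\lambda_j+\lambda}Z_j^2\le a_\lambda\big]$ with $Z_1,\dots,Z_K$ i.i.d. $\mathcal{N}(0,1)$. *)

theory Defs
  imports "HOL-Probability.Probability"
begin

text \<open>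
  The inference is finite-population: the covariate matrix \<open>x\<close> (units are rows) and the potential
  outcomes \<open>Y1\<close>, \<open>Y0\<close> are fixed, and the assignment vector \<open>W\<close> on the sample space \<open>M\<close> is the only
  source of randomness. ``Given \<open>x\<close>'' therefore needs no further conditioning.
\<close>

definition diag_matrix :: "('k \<Rightarrow> real) \<Rightarrow> real^'k^'k" where
  "diag_matrix d = (\<chi> i j. if i = j then d i else 0)"

definition positive_definite :: "real^'k^'k \<Rightarrow> bool" where
  "positive_definite A \<longleftrightarrow> transpose A = A \<and> (\<forall>v. v \<noteq> 0 \<longrightarrow> 0 < v \<bullet> (A *v v))"

definition is_projection_onto :: "('a::real_inner) set \<Rightarrow> 'a \<Rightarrow> 'a \<Rightarrow> bool" where
  "is_projection_onto S u p \<longleftrightarrow> p \<in> S \<and> (\<forall>v\<in>S. orthogonal (u - p) v)"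

text \<open>Density of the normal law \<open>N(\<mu>, \<Sigma>)\<close> for positive definite \<open>\<Sigma>\<close>.\<close>

definition mvnormal_density :: "real^'k \<Rightarrow> real^'k^'k \<Rightarrow> real^'k \<Rightarrow> real" where
  "mvnormal_density \<mu> \<Sigma> v =
     exp (- ((v - \<mu>) \<bullet> (matrix_inv \<Sigma> *v (v - \<mu>))) / 2) / sqrt ((2 * pi) ^ CARD('k) * det \<Sigma>)"

definition multivariate_normal ::
    "'a measure \<Rightarrow> ('a \<Rightarrow> real^'k) \<Rightarrow> real^'k \<Rightarrow> real^'k^'k \<Rightarrow> bool" where
  "multivariate_normal M X \<mu> \<Sigma> \<longleftrightarrow>
     distributed M lborel X (\<lambda>v. ennreal (mvnormal_density \<mu> \<Sigma> v))"

text \<open>\<open>indep_var\<close> forces both variables to have the same type; this is its unfolding without that.\<close>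

definition indep_rv :: "'a measure \<Rightarrow> ('a \<Rightarrow> 'b::topological_space) \<Rightarrow> ('a \<Rightarrow> 'c::topological_space) \<Rightarrow> bool" where
  "indep_rv M X Y \<longleftrightarrow>
     X \<in> borel_measurable M \<and> Y \<in> borel_measurable M \<and>
     prob_space.indep_set M {X -` A \<inter> space M | A. A \<in> sets borel} {Y -` B \<inter> space M | B. B \<in> sets borel}"

definition rvariance :: "'a measure \<Rightarrow> ('a \<Rightarrow> real) \<Rightarrow> real" where
  "rvariance M X = (\<integral>\<omega>. (X \<omega> - (\<integral>\<omega>'. X \<omega>' \<partial>M))\<^sup>2 \<partial>M)"

text \<open>
  \<open>E[X | V \<le> a]\<close>. This is the elementary conditional expectation when the event \<open>V \<le> a\<close> has positive
  probability. If it is a null event (for a distance \<open>V \<ge> 0\<close> with a continuous law: the case \<open>a = 0\<close>),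
  the value is the limit of \<open>E[X | V \<le> b]\<close> as \<open>b\<close> decreases to \<open>a\<close>.
\<close>

definition cond_expectation_le :: "'a measure \<Rightarrow> ('a \<Rightarrow> real) \<Rightarrow> real \<Rightarrow> ('a \<Rightarrow> real) \<Rightarrow> real" where
  "cond_expectation_le M V a X =
     (if 0 < measure M {\<omega> \<in> space M. V \<omega> \<le> a}
      then \<integral>\<omega>. X \<omega> \<partial>uniform_measure M {\<omega> \<in> space M. V \<omega> \<le> a}
      else Lim (at_right a) (\<lambda>b. \<integral>\<omega>. X \<omega> \<partial>uniform_measure M {\<omega> \<in> space M. V \<omega> \<le> b}))"

definition cond_variance_le :: "'a measure \<Rightarrow> ('a \<Rightarrow> real) \<Rightarrow> real \<Rightarrow> ('a \<Rightarrow> real) \<Rightarrow> real" where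
  "cond_variance_le M V a X =
     cond_expectation_le M V a (\<lambda>\<omega>. (X \<omega> - cond_expectation_le M V a X)\<^sup>2)"

text \<open>
  The uniform draw of \<open>W\<close> among the 0/1 vectors with \<open>NT\<close> ones makes every mean difference a discrete
  random vector, so it cannot satisfy a normality assumption with positive definite covariance
  literally: that assumption is an idealization. To keep it satisfiable, \<open>random_assignment\<close> only
  retains that \<open>W\<close> is a square integrable random vector whose entries sum to \<open>NT\<close>. Complete
  randomization is the special case shown below.
\<close>

definition random_assignment :: "'a measure \<Rightarrow> nat \<Rightarrow> ('a \<Rightarrow> real^'n) \<Rightarrow> bool" where
  "random_assignment M NT W \<longleftrightarrow>
     prob_space M \<and> W \<in> borel_measurable M \<and>
     (\<forall>i. integrable M (\<lambda>\<omega>. (W \<omega> $ i)\<^sup>2)) \<and>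
     (AE \<omega> in M. (\<Sum>i\<in>UNIV. W \<omega> $ i) = real NT)"

definition assignments :: "nat \<Rightarrow> (real^'n) set" where
  "assignments NT = {w. (\<forall>i. w $ i \<in> {0, 1}) \<and> (\<Sum>i\<in>UNIV. w $ i) = real NT}"

definition completely_randomized :: "'a measure \<Rightarrow> nat \<Rightarrow> ('a \<Rightarrow> real^'n) \<Rightarrow> bool" where
  "completely_randomized M NT W \<longleftrightarrow>
     prob_space M \<and> W \<in> borel_measurable M \<and>
     (\<forall>w\<in>assignments NT. measure M {\<omega> \<in> space M. W \<omega> = w} = 1 / card (assignments NT :: (real^'n) set))"

text \<open>Covariate mean vectors of the two arms; \<open>1\<close> is the all-ones vector.\<close>

definition xbar_T :: "nat \<Rightarrow> real^'k^'n \<Rightarrow> real^'n \<Rightarrow> real^'k" where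
  "xbar_T NT x w = (1 / real NT) *\<^sub>R (transpose x *v w)"

definition xbar_C :: "nat \<Rightarrow> real^'k^'n \<Rightarrow> real^'n \<Rightarrow> real^'k" where
  "xbar_C NC x w = (1 / real NC) *\<^sub>R (transpose x *v (1 - w))"

definition mean_T :: "nat \<Rightarrow> real^'n \<Rightarrow> real^'n \<Rightarrow> real" where
  "mean_T NT u w = (w \<bullet> u) / real NT"

definition mean_C :: "nat \<Rightarrow> real^'n \<Rightarrow> real^'n \<Rightarrow> real" where
  "mean_C NC u w = ((1 - w) \<bullet> u) / real NC"

definition centered :: "real^'k^'n \<Rightarrow> real^'k^'n" where
  "centered x = (\<chi> i k. x $ i $ k - (\<Sum>j\<in>UNIV. x $ j $ k) / real CARD('n))"

definition sample_cov :: "real^'k^'n \<Rightarrow> real^'k^'k" where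
  "sample_cov x = (1 / (real CARD('n) - 1)) *\<^sub>R (transpose (centered x) ** centered x)"

definition cov_mean_diff :: "nat \<Rightarrow> nat \<Rightarrow> real^'k^'n \<Rightarrow> real^'k^'k" where
  "cov_mean_diff NT NC x = (real CARD('n) / (real NT * real NC)) *\<^sub>R sample_cov x"

definition ridge_mahalanobis :: "nat \<Rightarrow> nat \<Rightarrow> real^'k^'n \<Rightarrow> real \<Rightarrow> real^'n \<Rightarrow> real" where
  "ridge_mahalanobis NT NC x l w =
     (let D = xbar_T NT x w - xbar_C NC x w
      in D \<bullet> (matrix_inv (cov_mean_diff NT NC x + l *\<^sub>R mat 1) *v D))"

definition average_treatment_effect :: "real^'n \<Rightarrow> real^'n \<Rightarrow> real" where
  "average_treatment_effect Y1 Y0 = (\<Sum>i\<in>UNIV. Y1 $ i - Y0 $ i) / real CARD('n)"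

definition y_obs :: "real^'n \<Rightarrow> real^'n \<Rightarrow> real^'n \<Rightarrow> real^'n" where
  "y_obs Y1 Y0 w = (\<chi> i. w $ i * Y1 $ i + (1 - w $ i) * Y0 $ i)"

text \<open>
  For 0/1 assignments the treated units show \<open>Y1\<close> and the control units \<open>Y0\<close>, so these are the arm
  means of the observed outcomes, see \<open>tau_hat_eq\<close>. Writing them through \<open>Y1\<close> and \<open>Y0\<close> avoids the
  identity \<open>W\<^sub>i\<^sup>2 = W\<^sub>i\<close>, which \<open>random_assignment\<close> does not provide.
\<close>

definition tau_hat :: "nat \<Rightarrow> nat \<Rightarrow> real^'n \<Rightarrow> real^'n \<Rightarrow> real^'n \<Rightarrow> real" where
  "tau_hat NT NC Y1 Y0 w = mean_T NT Y1 w - mean_C NC Y0 w"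

definition d_coeff :: "('k::finite \<Rightarrow> real) \<Rightarrow> real \<Rightarrow> real \<Rightarrow> 'k \<Rightarrow> real" where
  "d_coeff lam l a k =
     cond_expectation_le (\<Pi>\<^sub>M j\<in>UNIV. density lborel (\<lambda>t. ennreal (std_normal_density t)))
       (\<lambda>z. \<Sum>j\<in>UNIV. lam j / (lam j + l) * (z j)\<^sup>2) a (\<lambda>z. (z k)\<^sup>2)"

lemma tau_hat_eq:
  assumes "w \<in> assignments NT"
  shows "tau_hat NT NC Y1 Y0 w = mean_T NT (y_obs Y1 Y0 w) w - mean_C NC (y_obs Y1 Y0 w) w"
proof -
  have w: "w $ i = 0 \<or> w $ i = 1" for i
    using assms by (auto simp: assignments_def)
  have "w \<bullet> y_obs Y1 Y0 w = w \<bullet> Y1"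
    unfolding inner_vec_def y_obs_def
  proof (rule sum.cong[OF refl])
    fix i show "w $ i \<bullet> (\<chi> i. w $ i * Y1 $ i + (1 - w $ i) * Y0 $ i) $ i = w $ i \<bullet> Y1 $ i"
      using w[of i] by auto
  qed
  moreover have "(1 - w) \<bullet> y_obs Y1 Y0 w = (1 - w) \<bullet> Y0"
    unfolding inner_vec_def y_obs_def
  proof (rule sum.cong[OF refl])
    fix i show "(1 - w) $ i \<bullet> (\<chi> i. w $ i * Y1 $ i + (1 - w $ i) * Y0 $ i) $ i = (1 - w) $ i \<bullet> Y0 $ i"
      using w[of i] by auto
  qed
  ultimately show ?thesis
    by (simp add: tau_hat_def mean_T_def mean_C_def)
qed

lemma finite_assignments: "finite (assignments NT :: (real^'n) set)"
proof -
  have "(assignments NT :: (real^'n) set) \<subseteq> vec_lambda ` (UNIV \<rightarrow>\<^sub>E {0, 1})"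
  proof
    fix w :: "real^'n" assume "w \<in> assignments NT"
    then have "vec_nth w \<in> UNIV \<rightarrow>\<^sub>E {0, 1}" by (auto simp: assignments_def)
    then show "w \<in> vec_lambda ` (UNIV \<rightarrow>\<^sub>E {0, 1})"
      by (metis image_eqI vec_nth_inverse)
  qed
  moreover have "finite ((UNIV :: 'n set) \<rightarrow>\<^sub>E {0, 1 :: real})"
    by (intro finite_PiE) auto
  ultimately show ?thesis by (meson finite_imageI finite_subset)
qed

lemma assignments_nonempty:
  assumes "NT \<le> CARD('n)"
  shows "(assignments NT :: (real^'n) set) \<noteq> {}"
proof -
  obtain S :: "'n set" where S: "card S = NT"
    using obtain_subset_with_card_n[OF assms] by metis
  have "(\<Sum>i\<in>UNIV. if i \<in> S then 1 else 0 :: real) = real (card S)"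
    by (simp add: sum.If_cases)
  then have "(\<chi> i. if i \<in> S then 1 else 0) \<in> assignments NT"
    using S by (simp add: assignments_def)
  then show ?thesis by blast
qed

lemma completely_randomized_imp_random_assignment:
  fixes W :: "'a \<Rightarrow> real^'n"
  assumes cr: "completely_randomized M NT W" and NT: "NT \<le> CARD('n)"
  shows "random_assignment M NT W"
proof -
  let ?A = "assignments NT :: (real^'n) set"
  interpret prob_space M using cr by (simp add: completely_randomized_def)
  have W[measurable]: "W \<in> borel_measurable M" using cr by (simp add: completely_randomized_def)
  have p: "prob {\<omega> \<in> space M. W \<omega> = w} = 1 / card ?A" if "w \<in> ?A" for w
    using cr that by (simp add: completely_randomized_def)
  have Wi[measurable]: "(\<lambda>\<omega>. W \<omega> $ i) \<in> borel_measurable M" for i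
    by (rule measurable_compose[OF W borel_measurable_continuous_onI])
       (intro continuous_intros)
  have ev: "{\<omega> \<in> space M. W \<omega> = w} \<in> events" for w
    by measurable
  have "prob (\<Union>w\<in>?A. {\<omega> \<in> space M. W \<omega> = w}) = (\<Sum>w\<in>?A. prob {\<omega> \<in> space M. W \<omega> = w})"
    using ev finite_assignments
    by (intro finite_measure_finite_Union) (auto simp: disjoint_family_on_def)
  also have "\<dots> = 1"
    using p finite_assignments assignments_nonempty[OF NT] by (simp add: card_gt_0_iff)
  finally have "AE \<omega> in M. \<omega> \<in> (\<Union>w\<in>?A. {\<omega> \<in> space M. W \<omega> = w})"
    using ev finite_assignments by (intro AE_prob_1)
  then have A: "AE \<omega> in M. W \<omega> \<in> ?A" by eventually_elim auto
  have "integrable M (\<lambda>\<omega>. (W \<omega> $ i)\<^sup>2)" for i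
  proof (rule integrable_const_bound[where B = 1])
    show "AE \<omega> in M. norm ((W \<omega> $ i)\<^sup>2) \<le> 1"
      using A
    proof eventually_elim
      case (elim \<omega>)
      then have "W \<omega> $ i = 0 \<or> W \<omega> $ i = 1" by (auto simp: assignments_def)
      then show ?case by auto
    qed
  qed measurable
  moreover have "AE \<omega> in M. (\<Sum>i\<in>UNIV. W \<omega> $ i) = real NT"
    using A by eventually_elim (simp add: assignments_def)
  ultimately show ?thesis
    by (simp add: random_assignment_def prob_space_axioms)
qed

end

(*
The estimator is almost surely \<tau> + \<beta> \<bullet> D + E with E independent of D, so conditioning on an
event of D changes only the contribution of \<beta> \<bullet> D. Writing D in law as \<Gamma> (sqrt lam_k Z_k)_k with
Z standard normal, the acceptance event becomes the ellipsoid Sum lam_k / (lam_k + l) Z_k^2 <= a,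
which is invariant under each sign change Z_k -> - Z_k. Hence the conditional mean of \<beta> \<bullet> D and all
mixed second moments of Z vanish, and the variance reduction is a weighted sum of the 1 - d_k.
To see d_k < 1, fix all coordinates but the k-th: the remaining integral of 1 - t^2 against the
normal density \<phi> over an interval [-s, s] is 2 s \<phi>(s), since t \<phi>(t) is an antiderivative.
*)
theory Submission
  imports Defs
begin

text \<open>The normal law is given by a density on vectors, while \<open>d_coeff\<close> integrates
  over a product of functions. The two are matched without computing a Jacobian or a determinant:
  both measures have total mass 1, which settles the unknown constant. The weights
  \<open>lam k / (lam k + l)\<close> arise because the ridge term keeps the eigenvectors of \<Sigma>
  and shifts its eigenvalues to \<open>lam k + l\<close>, while the k-th coordinate of D in that
  basis is sqrt lam_k Z_k. The other obstacle is \<open>a = 0\<close>, where the acceptance event is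
  null and conditional expectations are limits from the right. Truncated moments are therefore
  studied as functions of a threshold b > 0. As b tends to 0 the ellipsoid shrinks to the origin,
  all d_k become 0, and the whole contribution of \<beta> \<bullet> D is removed. Conditioning does
  not move the mean of the estimator, so both variances are second moments about the same constant,
  and the variance of E cancels in their difference. Strictness d_k < 1 for every k is what turns a
  vanishing reduction into \<beta> = 0.\<close>

subsection \<open>Linear images of Lebesgue measure\<close>

text \<open>
  Uniqueness of Haar measure by Fubini: \<open>\<integral>f(L x) dx \<sqdot> \<integral>g(y) dy\<close> is symmetric in \<open>f\<close> and \<open>g\<close>. The constant
  stays unspecified, because for densities it is recovered by normalization. The change of variables
  theorem of the library needs an index type of class \<open>wellorder\<close>.
\<close>

lemma nn_integral_lborel_linear:
  fixes L :: "'a::euclidean_space \<Rightarrow> 'a"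
  assumes L: "linear L" "bij L"
  obtains c :: ennreal where "0 < c" "c < \<infinity>"
    "\<And>f. f \<in> borel_measurable borel \<Longrightarrow> (\<integral>\<^sup>+x. f x \<partial>lborel) = c * (\<integral>\<^sup>+x. f (L x) \<partial>lborel)"
proof -
  have cont: "continuous_on UNIV L" by (rule linear_continuous_on[OF linear_conv_bounded_linear[THEN iffD1, OF L(1)]])
  have lin': "linear (inv L)" using L by (intro inj_linear_imp_inv_linear) (auto dest: bij_is_inj)
  have cont': "continuous_on UNIV (inv L)"
    by (rule linear_continuous_on[OF linear_conv_bounded_linear[THEN iffD1, OF lin']])
  have [measurable]: "L \<in> borel_measurable borel" "inv L \<in> borel_measurable borel"
    using cont cont' by (auto intro: borel_measurable_continuous_onI)
  have Linv: "L (inv L y) = y" for y using L(2) by (simp add: bij_is_surj surj_f_inv_f)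
  have shift: "(\<integral>\<^sup>+x. h (t + x) \<partial>lborel) = (\<integral>\<^sup>+x. h x \<partial>lborel)"
    if [measurable]: "h \<in> borel_measurable borel" for h :: "'a \<Rightarrow> ennreal" and t
    using nn_integral_distr[of "\<lambda>x. t + x" lborel borel h] lborel_distr_plus[of t] by simp
  have refl: "(\<integral>\<^sup>+x. h (- x) \<partial>lborel) = (\<integral>\<^sup>+x. h x \<partial>lborel)"
    if [measurable]: "h \<in> borel_measurable borel" for h :: "'a \<Rightarrow> ennreal"
    by (subst (2) lborel_affine[of "-1" 0]) (simp_all add: nn_integral_density nn_integral_distr)
  have key: "(\<integral>\<^sup>+x. f (L x) \<partial>lborel) * (\<integral>\<^sup>+y. g y \<partial>lborel) = (\<integral>\<^sup>+x. g (L x) \<partial>lborel) * (\<integral>\<^sup>+y. f y \<partial>lborel)"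
    if [measurable]: "f \<in> borel_measurable borel" "g \<in> borel_measurable borel" for f g :: "'a \<Rightarrow> ennreal"
  proof -
    have "(\<integral>\<^sup>+x. f (L x) \<partial>lborel) * (\<integral>\<^sup>+y. g y \<partial>lborel) = (\<integral>\<^sup>+x. f (L x) * (\<integral>\<^sup>+y. g (L x + y) \<partial>lborel) \<partial>lborel)"
      by (simp add: shift nn_integral_multc)
    also have "\<dots> = (\<integral>\<^sup>+x. (\<integral>\<^sup>+y. f (L x) * g (L x + y) \<partial>lborel) \<partial>lborel)"
      by (simp add: nn_integral_cmult)
    also have "\<dots> = (\<integral>\<^sup>+y. (\<integral>\<^sup>+x. f (L x) * g (L x + y) \<partial>lborel) \<partial>lborel)"
      by (rule lborel_pair.Fubini') simp
    \<comment> \<open>Translating x by the preimage of y under L moves y from the argument of g to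
      that of f. Afterwards y is integrated out of f by reflection and translation.\<close>
    also have "\<dots> = (\<integral>\<^sup>+y. (\<integral>\<^sup>+x. f (L x - y) * g (L x) \<partial>lborel) \<partial>lborel)"
    proof (rule nn_integral_cong)
      fix y
      show "(\<integral>\<^sup>+x. f (L x) * g (L x + y) \<partial>lborel) = (\<integral>\<^sup>+x. f (L x - y) * g (L x) \<partial>lborel)"
        by (subst shift[where t = "inv L y", symmetric])
           (simp_all add: linear_add[OF L(1)] Linv linear_diff[OF L(1)] shift[where t = "- inv L y" and h = "\<lambda>x. f (L x) * g (L x + y)", symmetric] linear_neg[OF L(1)] algebra_simps)
    qed
    also have "\<dots> = (\<integral>\<^sup>+x. (\<integral>\<^sup>+y. f (L x - y) * g (L x) \<partial>lborel) \<partial>lborel)"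
      by (rule lborel_pair.Fubini') simp
    also have "\<dots> = (\<integral>\<^sup>+x. g (L x) * (\<integral>\<^sup>+y. f (L x + - y) \<partial>lborel) \<partial>lborel)"
      by (simp add: nn_integral_cmult mult.commute)
    also have "\<dots> = (\<integral>\<^sup>+x. g (L x) * (\<integral>\<^sup>+y. f y \<partial>lborel) \<partial>lborel)"
      by (subst refl) (simp_all add: shift)
    finally show ?thesis by (simp add: nn_integral_multc)
  qed
  \<comment> \<open>The unit ball serves as test function g, so the constant is the volume of
    \<open>U\<close> over that of its preimage \<open>V\<close>. Since \<open>V\<close> contains a
    ball and is bounded, both volumes are positive and finite.\<close>
  define U where "U = ball (0::'a) 1"
  define V where "V = L -` U"
  have "open V" unfolding V_def U_def using cont by (intro open_vimage) auto
  moreover have "0 \<in> V" by (simp add: V_def U_def linear_0[OF L(1)])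
  ultimately obtain r where r: "r > 0" "ball 0 r \<subseteq> V" by (auto simp: open_contains_ball)
  have ball0: "emeasure lborel (ball (0::'a) s) > 0" if "s > 0" for s
    using that by (simp add: emeasure_ball unit_ball_vol_pos)
  have V0: "emeasure lborel V > 0"
    using ball0[OF r(1)] r(2) \<open>open V\<close> by (metis emeasure_mono lborelD order_less_le_trans borel_open)
  have "V = inv L ` U" unfolding V_def using L(2) by (simp add: bij_vimage_eq_inv_image)
  then have "bounded V" unfolding U_def
    by (metis bounded_ball bounded_linear_image linear_conv_bounded_linear lin')
  then have V1: "emeasure lborel V < \<infinity>"
    by (rule emeasure_bounded_finite)
  have U0: "emeasure lborel U > 0" 
    unfolding U_def by (simp add: ball0)
  have U1: "emeasure lborel U < \<infinity>"
    unfolding U_def by (rule emeasure_bounded_finite) simp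
  have [measurable]: "U \<in> sets borel" "V \<in> sets borel" 
    using \<open>open V\<close> by (auto simp: U_def)
  have iL: "indicator U (L x) = indicator V x" for x by (simp add: V_def indicator_def)
  show thesis
  proof (rule that)
    show "0 < emeasure lborel U / emeasure lborel V" 
      using U0 V1 by (simp add: ennreal_zero_less_divide)
    show "emeasure lborel U / emeasure lborel V < \<infinity>"
      using U1 V0 by (auto simp: ennreal_divide_eq_top_iff simp flip: less_top)
    fix f :: "'a \<Rightarrow> ennreal" assume [measurable]: "f \<in> borel_measurable borel"
    have "(\<integral>\<^sup>+x. f (L x) \<partial>lborel) * emeasure lborel U = emeasure lborel V * (\<integral>\<^sup>+x. f x \<partial>lborel)"
      using key[of f "indicator U"] by (simp add: iL)
    then have "emeasure lborel U * (\<integral>\<^sup>+x. f (L x) \<partial>lborel) / emeasure lborel V = (\<integral>\<^sup>+x. f x \<partial>lborel)"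
      using V0 V1 by (simp add: mult.commute ennreal_mult_divide_eq)
    then show "(\<integral>\<^sup>+x. f x \<partial>lborel) = emeasure lborel U / emeasure lborel V * (\<integral>\<^sup>+x. f (L x) \<partial>lborel)"
      by (simp add: ennreal_times_divide mult.commute)
  qed
qed

text \<open>The factors enter only through their Borel sets, so that products of
  \<open>lborel\<close> and products of \<open>std_normal\<close> are both covered.\<close>

lemma borel_measurable_vec_lambda:
  assumes "\<And>i. sets (M i) = sets borel"
  shows "vec_lambda \<in> borel_measurable (PiM (UNIV :: 'k::finite set) (M :: 'k \<Rightarrow> real measure))"
proof (rule borel_measurable_euclidean_space[THEN iffD2], rule ballI)
  fix b :: "real^'k" assume "b \<in> Basis"
  then obtain i where b: "b = axis i 1" by (auto simp: Basis_vec_def)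
  have "(\<lambda>x. x i) \<in> measurable (PiM UNIV M) (M i)" by simp
  then have "(\<lambda>x. x i) \<in> borel_measurable (PiM UNIV M)"
    by (simp only: measurable_cong_sets[OF refl assms])
  then show "(\<lambda>x. vec_lambda x \<bullet> b) \<in> borel_measurable (PiM UNIV M)"
    by (simp add: b inner_axis)
qed

text \<open>Boxes determine \<open>lborel\<close>, and a box pulls back under
  \<open>vec_lambda\<close> to a product of intervals. This carries integrals over vectors to the
  product space on which \<open>d_coeff\<close> lives.\<close>

lemma lborel_vec_eq: "(lborel :: (real^'k) measure) = distr (PiM UNIV (\<lambda>_. lborel)) borel vec_lambda"
proof (rule lborel_eqI)
  interpret product_sigma_finite "\<lambda>_::'k. lborel :: real measure" ..
  have m: "vec_lambda \<in> borel_measurable (PiM (UNIV::'k set) (\<lambda>_. lborel :: real measure))"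
    by (rule borel_measurable_vec_lambda) simp
  fix l u :: "real^'k" assume le: "\<And>b. b \<in> Basis \<Longrightarrow> l \<bullet> b \<le> u \<bullet> b"
  have le': "l $ i \<le> u $ i" for i using le[of "axis i 1"] by (simp add: inner_axis)
  have "emeasure (distr (PiM UNIV (\<lambda>_. lborel)) borel vec_lambda) (box l u) =
      emeasure (PiM UNIV (\<lambda>_. lborel)) (PiE UNIV (\<lambda>i. {l $ i <..< u $ i}))"
    using m by (subst emeasure_distr) (auto simp: mem_box_cart space_PiM PiE_iff intro!: arg_cong2[where f = emeasure])
  also have "\<dots> = (\<Prod>i\<in>UNIV. ennreal (u $ i - l $ i))"
    using le' by (subst emeasure_PiM) simp_all
  also have "\<dots> = (\<Prod>b\<in>(\<lambda>i. axis i 1) ` UNIV. ennreal ((u - l) \<bullet> b))"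
    by (subst prod.reindex) (auto simp: inj_on_def axis_eq_axis inner_axis)
  also have "(\<lambda>i. axis i 1) ` UNIV = (Basis :: (real^'k) set)"
    by (auto simp: Basis_vec_def)
  finally show "emeasure (distr (PiM UNIV (\<lambda>_. lborel)) borel vec_lambda) (box l u) = (\<Prod>b\<in>Basis. (u - l) \<bullet> b)"
    using le by (subst prod_ennreal[symmetric]) (auto simp: inner_diff_left)
qed simp

text \<open>The indicator of a rectangle is the product of the indicators of its sides, so the
  integral of the product density splits into one-dimensional ones; rectangles determine the product
  measure.\<close>

lemma PiM_density_lborel:
  fixes f :: "'i \<Rightarrow> real \<Rightarrow> ennreal"
  assumes "finite I" and f: "\<And>i. f i \<in> borel_measurable borel"
    and sf: "\<And>i. sigma_finite_measure (density lborel (f i))"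
  shows "PiM I (\<lambda>i. density lborel (f i)) = density (PiM I (\<lambda>_. lborel)) (\<lambda>x. \<Prod>i\<in>I. f i (x i))"
proof -
  interpret A: product_sigma_finite "\<lambda>i. density lborel (f i)" using sf by (simp add: product_sigma_finite_def)
  interpret B: product_sigma_finite "\<lambda>_::'i. lborel :: real measure" ..
  have [measurable]: "f i \<in> borel_measurable borel" for i by (fact f)
  have S: "sets (PiM I (\<lambda>i. density lborel (f i))) = sets (PiM I (\<lambda>_. lborel))"
    by (rule sets_PiM_cong) auto
  show ?thesis
  proof (rule A.PiM_eqI[symmetric, OF assms(1)])
    show "sets (density (PiM I (\<lambda>_. lborel)) (\<lambda>x. \<Prod>i\<in>I. f i (x i))) = sets (PiM I (\<lambda>i. density lborel (f i)))"
      by (simp add: S)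
    fix A assume A: "\<And>i. i \<in> I \<Longrightarrow> A i \<in> sets (density lborel (f i))"
    then have [measurable]: "PiE I A \<in> sets (PiM I (\<lambda>_. lborel))" 
      using assms(1) by (intro sets_PiM_I_finite) auto
    have "emeasure (density (PiM I (\<lambda>_. lborel)) (\<lambda>x. \<Prod>i\<in>I. f i (x i))) (Pi\<^sub>E I A) =
      (\<integral>\<^sup>+x. (\<Prod>i\<in>I. f i (x i)) * indicator (PiE I A) x \<partial>PiM I (\<lambda>_. lborel))"
      by (subst emeasure_density) auto
    also have "\<dots> = (\<integral>\<^sup>+x. (\<Prod>i\<in>I. f i (x i) * indicator (A i) (x i)) \<partial>PiM I (\<lambda>_. lborel))"
    proof (rule nn_integral_cong)
      fix x assume "x \<in> space (PiM I (\<lambda>_. lborel :: real measure))"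
      then have "indicator (PiE I A) x = (\<Prod>i\<in>I. indicator (A i) (x i) :: ennreal)"
        using assms(1) by (auto simp: indicator_def space_PiM PiE_def Pi_def prod_zero_iff)
      then show "(\<Prod>i\<in>I. f i (x i)) * indicator (PiE I A) x = (\<Prod>i\<in>I. f i (x i) * indicator (A i) (x i))"
        by (simp add: prod.distrib)
    qed
    also have "\<dots> = (\<Prod>i\<in>I. \<integral>\<^sup>+t. f i t * indicator (A i) t \<partial>lborel)"
      using A assms(1) by (intro B.product_nn_integral_prod) auto
    also have "\<dots> = (\<Prod>i\<in>I. emeasure (density lborel (f i)) (A i))"
      using A by (intro prod.cong refl) (auto simp: emeasure_density)
    finally show "emeasure (density (PiM I (\<lambda>_. lborel)) (\<lambda>x. \<Prod>i\<in>I. f i (x i))) (Pi\<^sub>E I A) = \<dots>" .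
  qed
qed

subsection \<open>Multivariate normal vectors\<close>

abbreviation std_normal :: "real measure" where
  "std_normal \<equiv> density lborel (\<lambda>t. ennreal (std_normal_density t))"

abbreviation std_normal_vec :: "('k::finite \<Rightarrow> real) measure" where
  "std_normal_vec \<equiv> PiM UNIV (\<lambda>_. std_normal)"

lemma prob_space_std_normal: "prob_space std_normal"
  by (rule prob_space_normal_density) simp

text \<open>\<open>matrix_inv\<close> is a choice by \<open>SOME\<close>; its value is pinned down
  because a two-sided inverse is unique.\<close>

lemma matrix_inv_eq:
  fixes A B :: "real^'k^'k"
  assumes "A ** B = mat 1" "B ** A = mat 1"
  shows "matrix_inv A = B"
proof -
  have "A ** matrix_inv A = mat 1 \<and> matrix_inv A ** A = mat 1"
    unfolding matrix_inv_def by (rule someI[of _ B]) (use assms in auto)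
  then have "matrix_inv A ** A ** B = B" by simp
  then show ?thesis using assms by (simp add: matrix_mul_assoc[symmetric])
qed

lemma diag_matrix_mult: "diag_matrix f ** diag_matrix g = (diag_matrix (\<lambda>k. f k * g k) :: real^'k^'k)"
  by (simp add: diag_matrix_def matrix_matrix_mult_def vec_eq_iff if_distrib[of "\<lambda>a. a * _"] cong: if_cong)

lemma diag_matrix_mult_vec: "diag_matrix f *v v = (\<chi> k. f k * v $ k)"
  by (simp add: diag_matrix_def matrix_vector_mult_def vec_eq_iff if_distrib[of "\<lambda>a. a * _"] cong: if_cong)

lemma matrix_inv_spectral:
  fixes G :: "real^'k^'k"
  assumes G: "orthogonal_matrix G" and f: "\<And>k. f k \<noteq> 0"
  shows "matrix_inv (G ** diag_matrix f ** transpose G) = G ** diag_matrix (\<lambda>k. 1 / f k) ** transpose G"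
proof (rule matrix_inv_eq)
  have one: "diag_matrix (\<lambda>k::'k. 1) = mat 1" by (simp add: diag_matrix_def mat_def)
  have GG: "transpose G ** G = mat 1" "G ** transpose G = mat 1" using G by (auto simp: orthogonal_matrix_def)
  have *: "(G ** A ** transpose G) ** (G ** B ** transpose G) = G ** (A ** B) ** transpose G" for A B
  proof -
    have "(G ** A ** transpose G) ** (G ** B ** transpose G) = G ** A ** (transpose G ** G) ** B ** transpose G"
      by (simp only: matrix_mul_assoc)
    then show ?thesis by (simp only: GG matrix_mul_rid matrix_mul_assoc)
  qed
  show "G ** diag_matrix f ** transpose G ** (G ** diag_matrix (\<lambda>k. 1 / f k) ** transpose G) = mat 1"
       "G ** diag_matrix (\<lambda>k. 1 / f k) ** transpose G ** (G ** diag_matrix f ** transpose G) = mat 1"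
    unfolding * diag_matrix_mult using f by (simp_all add: one GG)
qed

lemma inner_spectral:
  fixes G :: "real^'k^'k"
  shows "v \<bullet> ((G ** diag_matrix f ** transpose G) *v v) = (\<Sum>k\<in>UNIV. f k * ((transpose G *v v) $ k)\<^sup>2)"
proof -
  have "v \<bullet> ((G ** diag_matrix f ** transpose G) *v v) = (transpose G *v v) \<bullet> (diag_matrix f *v (transpose G *v v))"
    by (simp add: matrix_vector_mul_assoc[symmetric] dot_lmul_matrix[symmetric])
  then show ?thesis
    by (simp add: diag_matrix_mult_vec inner_vec_def power2_eq_square mult_ac)
qed

text \<open>For \<open>L = G diag(sqrt lam)\<close> the quadratic form of the inverse of \<Sigma> at
  L z is the squared length of z. Hence the density pulled back along L is a constant times the
  product of standard normal densities.\<close>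

lemma distr_multivariate_normal:
  fixes G \<Sigma> :: "real^'k^'k"
  assumes "prob_space M" and D: "multivariate_normal M D 0 \<Sigma>"
    and G: "orthogonal_matrix G" and S: "\<Sigma> = G ** diag_matrix lam ** transpose G"
    and lam: "\<And>k. 0 < lam k"
  shows "distr M borel D = distr std_normal_vec borel (\<lambda>z. G *v (\<chi> k. sqrt (lam k) * z k))"
proof -
  interpret M: prob_space M by fact
  interpret N: prob_space std_normal by (rule prob_space_std_normal)
  interpret P: product_prob_space "\<lambda>_::'k. std_normal" UNIV by unfold_locales
  define L :: "real^'k \<Rightarrow> real^'k" where "L z = G *v (diag_matrix (\<lambda>k. sqrt (lam k)) *v z)" for z
  define L' :: "real^'k \<Rightarrow> real^'k" where "L' z = diag_matrix (\<lambda>k. 1 / sqrt (lam k)) *v (transpose G *v z)" for z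
  have GG: "transpose G ** G = mat 1" "G ** transpose G = mat 1" using G by (auto simp: orthogonal_matrix_def)
  have GL: "transpose G *v L z = (\<chi> k. sqrt (lam k) * z $ k)" for z
    by (simp add: L_def matrix_vector_mul_assoc GG diag_matrix_mult_vec)
  have linL: "linear L" unfolding L_def by (simp add: matrix_vector_mul_assoc)
  have lam': "lam k \<noteq> 0" for k using lam[of k] by simp
  have "L' (L z) = z" for z
    unfolding L'_def GL using lam' by (simp add: diag_matrix_mult_vec vec_eq_iff)
  moreover have "L (L' z) = z" for z
  proof -
    have "diag_matrix (\<lambda>k. sqrt (lam k)) *v (diag_matrix (\<lambda>k. 1 / sqrt (lam k)) *v v) = v" for v :: "real^'k"
      using lam' by (simp add: diag_matrix_mult_vec vec_eq_iff)
    then have "L (L' z) = G *v (transpose G *v z)" by (simp only: L_def L'_def)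
    then show ?thesis by (simp add: matrix_vector_mul_assoc GG del: transpose_matrix_vector)
  qed
  ultimately have "bij L" by (intro o_bij[of L']) auto
  then obtain c where c: "\<And>f. f \<in> borel_measurable borel \<Longrightarrow> (\<integral>\<^sup>+x. f x \<partial>lborel) = c * (\<integral>\<^sup>+x. f (L x) \<partial>lborel)"
    by (rule nn_integral_lborel_linear[OF linL]) blast
  have Lm[measurable]: "L \<in> borel_measurable borel"
    using linear_continuous_on[OF linear_conv_bounded_linear[THEN iffD1, OF linL]]
    by (rule borel_measurable_continuous_onI)
  have vm[measurable]: "vec_lambda \<in> borel_measurable (PiM (UNIV::'k set) (\<lambda>_. lborel :: real measure))"
    "vec_lambda \<in> borel_measurable (std_normal_vec :: ('k \<Rightarrow> real) measure)"
    by (rule borel_measurable_vec_lambda; simp)+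
  define h where "h = (\<lambda>v. ennreal (mvnormal_density 0 \<Sigma> v))"
  have Dd: "distr M lborel D = density lborel h" and [measurable]: "h \<in> borel_measurable borel"
    and Dm: "D \<in> borel_measurable M"
    using D by (auto simp: multivariate_normal_def distributed_def h_def)
  define \<phi> where "\<phi> = (\<lambda>z::real^'k. \<Prod>k\<in>UNIV. ennreal (std_normal_density (z $ k)))"
  have [measurable]: "\<phi> \<in> borel_measurable borel" unfolding \<phi>_def by measurable
  \<comment> \<open>The ratio of the two normalizing factors; the determinant of \<Sigma> is left
    unevaluated.\<close>
  define C where "C = (sqrt (2 * pi)) ^ CARD('k) / sqrt ((2 * pi) ^ CARD('k) * det \<Sigma>)"
  have hL: "h (L z) = ennreal C * \<phi> z" for z
  proof -
    have "L z \<bullet> (matrix_inv \<Sigma> *v L z) = (\<Sum>k\<in>UNIV. (z $ k)\<^sup>2)"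
      unfolding S matrix_inv_spectral[OF G lam'] inner_spectral GL
      using lam by (simp add: power_mult_distrib lam' less_imp_le)
    then have "mvnormal_density 0 \<Sigma> (L z) = C * ((1 / sqrt (2 * pi)) ^ CARD('k) * exp (\<Sum>k\<in>UNIV. - (z $ k)\<^sup>2 / 2))"
      by (simp add: mvnormal_density_def C_def power_one_over sum_negf sum_divide_distrib)
    also have "\<dots> = C * (\<Prod>k\<in>UNIV. std_normal_density (z $ k))"
      by (simp only: std_normal_density_def prod.distrib exp_sum finite prod_constant)
    finally show ?thesis
      by (simp only: h_def \<phi>_def prod_ennreal normal_density_nonneg ennreal_mult'' prod_nonneg)
  qed
  have main: "emeasure (distr M borel D) A =
      c * ennreal C * emeasure (distr std_normal_vec borel (\<lambda>z. L (vec_lambda z))) A"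
    if A[measurable]: "A \<in> sets borel" for A
  proof -
    have "emeasure (distr M borel D) A = emeasure (distr M lborel D) A"
      using A Dm by (simp add: emeasure_distr)
    also have "\<dots> = (\<integral>\<^sup>+v. h v * indicator A v \<partial>lborel)"
      unfolding Dd by (simp add: emeasure_density)
    also have "\<dots> = c * (\<integral>\<^sup>+z. ennreal C * \<phi> z * indicator A (L z) \<partial>lborel)"
      by (subst c) (simp_all add: hL)
    also have "\<dots> = c * ennreal C * (\<integral>\<^sup>+z. \<phi> z * indicator A (L z) \<partial>lborel)"
      by (simp add: nn_integral_cmult mult.assoc)
    also have "(\<integral>\<^sup>+z. \<phi> z * indicator A (L z) \<partial>lborel) =
        (\<integral>\<^sup>+z. \<phi> (vec_lambda z) * indicator A (L (vec_lambda z)) \<partial>PiM UNIV (\<lambda>_. lborel))"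
      by (subst lborel_vec_eq, subst nn_integral_distr) simp_all
    also have "\<dots> = (\<integral>\<^sup>+z. indicator A (L (vec_lambda z)) \<partial>std_normal_vec)"
      by (subst PiM_density_lborel)
         (simp_all add: prob_space_imp_sigma_finite prob_space_std_normal nn_integral_density \<phi>_def)
    also have "\<dots> = emeasure (distr std_normal_vec borel (\<lambda>z. L (vec_lambda z))) A"
      by (simp add: nn_integral_distr flip: nn_integral_indicator)
    finally show ?thesis .
  qed
  \<comment> \<open>The volume factor \<open>c\<close> and the ratio \<open>C\<close> are eliminated
    together by comparing total masses.\<close>
  have "emeasure (distr M borel D) UNIV = 1" using Dm by (simp add: emeasure_distr M.emeasure_space_1)
  moreover have "emeasure (distr std_normal_vec borel (\<lambda>z. L (vec_lambda z))) UNIV = 1"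
    using P.emeasure_space_1 by (simp add: emeasure_distr)
  ultimately have "c * ennreal C = 1" using main[of UNIV] by simp
  then have "distr M borel D = distr std_normal_vec borel (\<lambda>z. L (vec_lambda z))"
    by (intro measure_eqI) (simp_all add: main)
  then show ?thesis by (simp add: L_def diag_matrix_mult_vec)
qed

section \<open>Conditional expectations as ratios of integrals\<close>

lemma integral_uniform_measure:
  fixes X :: "'a \<Rightarrow> real"
  assumes "finite_measure M" and A[measurable]: "A \<in> sets M" and X[measurable]: "X \<in> borel_measurable M"
    and pos: "0 < measure M A"
  shows "(\<integral>\<omega>. X \<omega> \<partial>uniform_measure M A) = (\<integral>\<omega>. indicator A \<omega> * X \<omega> \<partial>M) / measure M A"
proof -
  interpret finite_measure M by fact
  have "uniform_measure M A = density M (\<lambda>\<omega>. ennreal (indicator A \<omega> / measure M A))"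
    unfolding uniform_measure_def using pos
    by (intro density_cong) (auto simp: emeasure_eq_measure divide_ennreal ennreal_1[symmetric] simp del: ennreal_1 split: split_indicator)
  then show ?thesis
    by (simp add: integral_density)
qed

text \<open>Treats both branches of the definition at once: \<open>r b\<close> is the elementary
  conditional expectation at a threshold b > 0. At \<open>a = 0\<close> the event is null, and the
  limit of \<open>r\<close> from the right is the value.\<close>

lemma cond_expectation_le_eqI:
  fixes X V :: "'a \<Rightarrow> real"
  assumes M: "finite_measure M" and [measurable]: "V \<in> borel_measurable M" "X \<in> borel_measurable M"
    and pos: "\<And>b. 0 < b \<Longrightarrow> 0 < measure M {\<omega> \<in> space M. V \<omega> \<le> b}"
    and null: "measure M {\<omega> \<in> space M. V \<omega> \<le> 0} = 0"
    and r: "\<And>b. 0 < b \<Longrightarrow> (\<integral>\<omega>. indicator {\<omega> \<in> space M. V \<omega> \<le> b} \<omega> * X \<omega> \<partial>M)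
      = r b * measure M {\<omega> \<in> space M. V \<omega> \<le> b}"
    and a: "0 \<le> a" "0 < a \<Longrightarrow> r a = L" "a = 0 \<Longrightarrow> (r \<longlongrightarrow> L) (at_right 0)"
  shows "cond_expectation_le M V a X = L"
proof -
  have *: "(\<integral>\<omega>. X \<omega> \<partial>uniform_measure M {\<omega> \<in> space M. V \<omega> \<le> b}) = r b" if "0 < b" for b
    using pos[OF that] r[OF that] by (subst integral_uniform_measure[OF M]) auto
  show ?thesis
  proof (cases "a = 0")
    case True
    have "((\<lambda>b. \<integral>\<omega>. X \<omega> \<partial>uniform_measure M {\<omega> \<in> space M. V \<omega> \<le> b}) \<longlongrightarrow> L) (at_right 0)"
      using a(3)[OF True]
      by (rule Lim_transform_eventually) (auto simp: eventually_at_right_less * intro: eventually_mono[OF eventually_at_right_less])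
    then show ?thesis
      using True null by (simp add: cond_expectation_le_def tendsto_Lim)
  next
    case False
    then show ?thesis using a pos by (simp add: cond_expectation_le_def *)
  qed
qed

section \<open>Symmetry and moments of the standard normal vector\<close>

lemma emeasure_std_normal_uminus:
  assumes [measurable]: "A \<in> sets borel"
  shows "emeasure std_normal (uminus -` A) = emeasure std_normal A"
proof -
  have [measurable]: "uminus -` A \<in> sets borel"
    using measurable_sets[of uminus borel borel A] by simp
  have "emeasure std_normal A = (\<integral>\<^sup>+t. ennreal (std_normal_density t) * indicator A t \<partial>lborel)"
    by (simp add: emeasure_density)
  also have "\<dots> = (\<integral>\<^sup>+t. ennreal (std_normal_density (- t)) * indicator A (- t) \<partial>lborel)"
    by (subst nn_integral_real_affine[where c = "-1" and t = 0]) simp_all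
  also have "\<dots> = (\<integral>\<^sup>+t. ennreal (std_normal_density t) * indicator (uminus -` A) t \<partial>lborel)"
    by (intro nn_integral_cong) (simp add: std_normal_density_def indicator_def)
  finally show ?thesis by (simp add: emeasure_density)
qed

interpretation std_normal: prob_space std_normal
  by (rule prob_space_std_normal)

text \<open>The index set stays free because Fubini later splits off one coordinate and leaves the
  product over \<open>UNIV - {k}\<close>.\<close>

interpretation std_normal_product: product_prob_space "\<lambda>_. std_normal" I for I
  by unfold_locales

text \<open>The preimage of a rectangle is the rectangle with its k-th side reflected, and
  reflection preserves the normal measure of that side.\<close>

lemma flip_std_normal_vec:
  "distr std_normal_vec std_normal_vec (\<lambda>z. z(k := - z k)) = (std_normal_vec :: ('k::finite \<Rightarrow> real) measure)"
proof (rule std_normal_product.PiM_eqI)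
  fix A :: "'k \<Rightarrow> real set" assume "\<And>i. i \<in> UNIV \<Longrightarrow> A i \<in> sets std_normal"
  then have [measurable]: "A i \<in> sets borel" for i by simp
  define B where "B = A(k := uminus -` A k)"
  have [measurable]: "B i \<in> sets borel" for i
    using measurable_sets[of uminus borel borel "A k"] by (simp add: B_def)
  have [measurable]: "(\<lambda>z. z(k := - z k)) \<in> measurable std_normal_vec (std_normal_vec :: ('k \<Rightarrow> real) measure)"
    by (rule measurable_PiM_single') (auto simp: space_PiM)
  have "(\<lambda>z. z(k := - z k)) -` (PiE UNIV A) \<inter> space std_normal_vec = PiE UNIV B"
    by (auto simp: space_PiM PiE_iff B_def split: if_splits)
  then have "emeasure (distr std_normal_vec std_normal_vec (\<lambda>z. z(k := - z k))) (PiE UNIV A) =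
      emeasure std_normal_vec (PiE UNIV B)"
    by (subst emeasure_distr) (auto intro!: sets_PiM_I_finite)
  also have "\<dots> = (\<Prod>i\<in>UNIV. emeasure std_normal (B i))"
    by (subst std_normal_product.emeasure_PiM) auto
  also have "\<dots> = (\<Prod>i\<in>UNIV. emeasure std_normal (A i))"
    by (intro prod.cong) (auto simp: B_def emeasure_std_normal_uminus)
  finally show "emeasure (distr std_normal_vec std_normal_vec (\<lambda>z. z(k := - z k))) (PiE UNIV A) = \<dots>" .
qed auto

text \<open>Invariance under the flip makes the integral equal to its own negative. This includes
  non-integrable h, whose Bochner integral is 0 by default.\<close>

lemma integral_std_normal_vec_odd:
  fixes h :: "('k::finite \<Rightarrow> real) \<Rightarrow> real"
  assumes h: "h \<in> borel_measurable std_normal_vec"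
    and odd: "\<And>z. h (z(k := - z k)) = - h z"
  shows "(\<integral>z. h z \<partial>std_normal_vec) = 0"
proof -
  have m: "(\<lambda>z. z(k := - z k)) \<in> measurable std_normal_vec (std_normal_vec :: ('k \<Rightarrow> real) measure)"
    by (rule measurable_PiM_single') (auto simp: space_PiM)
  have "(\<integral>z. h z \<partial>std_normal_vec) = (\<integral>z. h (z(k := - z k)) \<partial>std_normal_vec)"
    using integral_distr[OF m h] by (simp add: flip_std_normal_vec)
  then show ?thesis by (simp add: odd)
qed

lemma integrable_std_normal_square: "integrable std_normal (\<lambda>t. t\<^sup>2)"
  and integral_std_normal_square: "(\<integral>t. t\<^sup>2 \<partial>std_normal) = 1"
  using std_normal_moment_even[of 1]
  by (simp_all add: integrable_density integral_density has_bochner_integral_iff mult.commute)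

lemma distr_std_normal_vec_component:
  "distr std_normal_vec std_normal (\<lambda>z. z k) = (std_normal :: real measure)"
  by (rule std_normal_product.PiM_component) simp

lemma integrable_std_normal_vec_square: "integrable std_normal_vec (\<lambda>z. (z k)\<^sup>2)"
  and integral_std_normal_vec_square: "(\<integral>z. (z k)\<^sup>2 \<partial>std_normal_vec) = 1"
proof -
  have m: "(\<lambda>z. z k) \<in> measurable std_normal_vec std_normal" by simp
  show "integrable std_normal_vec (\<lambda>z. (z k)\<^sup>2)"
    using integrable_distr_eq[OF m, of "\<lambda>t. t\<^sup>2"] integrable_std_normal_square
    by (simp add: distr_std_normal_vec_component)
  show "(\<integral>z. (z k)\<^sup>2 \<partial>std_normal_vec) = 1"
    using integral_distr[OF m, of "\<lambda>t. t\<^sup>2"] integral_std_normal_square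
    by (simp add: distr_std_normal_vec_component)
qed

section \<open>Positive measure of small ellipsoids\<close>

lemma emeasure_std_normal_interval_pos:
  assumes "c > 0"
  shows "emeasure std_normal {-c..c} > 0"
proof -
  have pos: "std_normal_density t \<noteq> 0" for t
    using normal_density_pos[of 1 0 t] by linarith
  have "emeasure std_normal {-c..c} \<noteq> 0"
  proof
    assume "emeasure std_normal {-c..c} = 0"
    then have "AE t in lborel. ennreal (std_normal_density t) * indicator {-c..c} t = 0"
      by (simp add: emeasure_density nn_integral_0_iff_AE)
    then have "AE t in lborel. t \<notin> {-c..c}"
      by eventually_elim (auto simp: indicator_def not_le pos split: if_splits)
    then have "emeasure lborel {-c..c} = 0"
      by (subst (asm) AE_iff_measurable[where N = "{-c..c}"]) auto
    then show False using assms by simp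
  qed
  then show ?thesis by (simp add: zero_less_iff_neq_zero)
qed

text \<open>A small cube with sides \<open>{-c..c}\<close> lies in the open ellipsoid and has
  positive measure. The set \<open>I\<close> may be empty, which is what remains of a single
  covariate once its coordinate is split off.\<close>

lemma emeasure_std_normal_quadratic_pos:
  fixes w :: "'i \<Rightarrow> real"
  assumes I: "finite I" and w: "\<And>i. i \<in> I \<Longrightarrow> 0 \<le> w i" and b: "0 < b"
  shows "0 < emeasure (PiM I (\<lambda>_. std_normal)) {z \<in> space (PiM I (\<lambda>_. std_normal)). (\<Sum>i\<in>I. w i * (z i)\<^sup>2) < b}"
proof -
  define s where "s = (\<Sum>i\<in>I. w i)"
  have s: "s \<ge> 0" using w by (simp add: s_def sum_nonneg)
  \<comment> \<open>On the cube the form is at most \<open>s * c^2 = s * b / (1 + s)\<close>. The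
    added 1 makes this strictly less than b and keeps the quotient defined for s = 0.\<close>
  define c where "c = sqrt (b / (1 + s))"
  have c: "c > 0" using s b by (simp add: c_def)
  have c2: "c\<^sup>2 = b / (1 + s)" using s b by (simp add: c_def)
  have sub: "PiE I (\<lambda>_. {-c..c}) \<subseteq> {z \<in> space (PiM I (\<lambda>_. std_normal)). (\<Sum>i\<in>I. w i * (z i)\<^sup>2) < b}"
  proof (rule subsetI, rule CollectI, rule conjI)
    fix z assume z: "z \<in> PiE I (\<lambda>_. {-c..c})"
    then show "z \<in> space (PiM I (\<lambda>_. std_normal))" by (simp add: space_PiM PiE_iff)
    have "(\<Sum>i\<in>I. w i * (z i)\<^sup>2) \<le> (\<Sum>i\<in>I. w i * c\<^sup>2)"
    proof (intro sum_mono mult_left_mono w)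
      fix i assume "i \<in> I"
      then have "\<bar>z i\<bar> \<le> c" using z by (auto simp: PiE_iff)
      then show "(z i)\<^sup>2 \<le> c\<^sup>2" using c by (simp add: abs_le_square_iff[symmetric])
    qed
    also have "\<dots> = s * b / (1 + s)" by (simp add: c2 s_def sum_distrib_right sum_divide_distrib)
    also have "\<dots> < b" using s b by (simp add: field_simps)
    finally show "(\<Sum>i\<in>I. w i * (z i)\<^sup>2) < b" .
  qed
  have "emeasure std_normal {-c..c} \<noteq> 0"
    using emeasure_std_normal_interval_pos[OF c] by (rule less_imp_neq[symmetric])
  then have "(\<Prod>i\<in>I. emeasure std_normal {-c..c}) \<noteq> 0"
    by simp
  then have "0 < (\<Prod>i\<in>I. emeasure std_normal {-c..c})"
    by (rule zero_less_iff_neq_zero[THEN iffD2])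
  also have "\<dots> = emeasure (PiM I (\<lambda>_. std_normal)) (PiE I (\<lambda>_. {-c..c}))"
    using I by (subst std_normal_product.emeasure_PiM) auto
  also have "\<dots> \<le> emeasure (PiM I (\<lambda>_. std_normal)) {z \<in> space (PiM I (\<lambda>_. std_normal)). (\<Sum>i\<in>I. w i * (z i)\<^sup>2) < b}"
    using I by (intro emeasure_mono sub) measurable
  finally show ?thesis .
qed

section \<open>Strict decrease of truncated second moments\<close>

lemma integral_std_normal_truncated:
  assumes s: "0 \<le> s"
  shows "(\<integral>t. indicator {-s..s} t * (1 - t\<^sup>2) \<partial>std_normal) = 2 * s * std_normal_density s"
proof -
  have "(\<integral>t. indicator {-s..s} t *\<^sub>R ((1 - t\<^sup>2) * std_normal_density t) \<partial>lborel)
      = s * std_normal_density s - (- s) * std_normal_density (- s)"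
  proof (rule integral_FTC_atLeastAtMost)
    fix t
    \<comment> \<open>\<open>C\<close> stands for \<open>1 / sqrt (2 * pi)\<close>, kept opaque
      while differentiating.\<close>
    have "((\<lambda>t. t * (C * exp (- t\<^sup>2 / 2))) has_real_derivative (1 - t\<^sup>2) * (C * exp (- t\<^sup>2 / 2))) (at t)" for C :: real
      by (auto intro!: derivative_eq_intros simp: algebra_simps power2_eq_square diff_divide_distrib)
    then show "((\<lambda>t. t * std_normal_density t) has_vector_derivative (1 - t\<^sup>2) * std_normal_density t) (at t within {-s..s})"
      unfolding std_normal_density_def has_real_derivative_iff_has_vector_derivative
      by (rule has_vector_derivative_at_within)
  next
    show "continuous_on {-s..s} (\<lambda>t. (1 - t\<^sup>2) * std_normal_density t)"
      unfolding std_normal_density_def by (intro continuous_intros) auto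
  qed (use s in auto)
  then show ?thesis
    by (simp add: integral_density std_normal_density_def mult_ac)
qed

text \<open>The difference of the two sides is the integral of \<open>1 - (z k)^2\<close> over the
  ellipsoid, an integrand without a fixed sign. Integrating out the k-th coordinate leaves a
  nonnegative function \<open>g\<close> of the others, positive on an open ellipsoid.\<close>

lemma truncated_second_moment_less:
  fixes w :: "'k::finite \<Rightarrow> real"
  assumes w: "\<And>j. 0 < w j" and b: "0 < b"
  shows "(\<integral>z. indicator {z \<in> space std_normal_vec. (\<Sum>j\<in>UNIV. w j * (z j)\<^sup>2) \<le> b} z * (z k)\<^sup>2 \<partial>std_normal_vec)
       < measure std_normal_vec {z \<in> space std_normal_vec. (\<Sum>j\<in>UNIV. w j * (z j)\<^sup>2) \<le> b}"
proof -
  let ?A = "{z \<in> space std_normal_vec. (\<Sum>j\<in>UNIV. w j * (z j)\<^sup>2) \<le> b}"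
  define I where "I = UNIV - {k}"
  have I: "finite I" "k \<notin> I" "insert k I = UNIV" by (auto simp: I_def)
  define rest where "rest = (\<lambda>y. \<Sum>j\<in>I. w j * (y j)\<^sup>2)"
  have [measurable]: "?A \<in> sets std_normal_vec" by measurable
  define h where "h = (\<lambda>z. indicator ?A z * (1 - (z k)\<^sup>2))"
  have i1: "integrable std_normal_vec (\<lambda>z. indicator ?A z * (z k)\<^sup>2)"
    using integrable_real_mult_indicator[OF _ integrable_std_normal_vec_square, of ?A k] by (simp add: mult.commute)
  have i2: "integrable std_normal_vec (indicator ?A :: _ \<Rightarrow> real)"
    by (simp add: integrable_indicator_iff std_normal_product.emeasure_eq_measure)
  have hi: "integrable std_normal_vec h" using i1 i2 by (simp add: h_def right_diff_distrib)
  \<comment> \<open>\<open>s\<close> is the half-length of the section of the ellipsoid in direction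
    k above y.\<close>
  define g where "g = (\<lambda>y. if rest y \<le> b then let s = sqrt ((b - rest y) / w k) in 2 * s * std_normal_density s else 0)"
  have g: "(\<integral>t. h (y(k := t)) \<partial>std_normal) = g y" for y
  proof -
    have "(\<Sum>j\<in>UNIV. w j * ((y(k := t)) j)\<^sup>2) = w k * t\<^sup>2 + rest y" for t
      by (subst I(3)[symmetric], subst sum.insert[OF I(1,2)]) (auto simp: rest_def I intro!: sum.cong)
    then have hy: "h (y(k := t)) = (if w k * t\<^sup>2 + rest y \<le> b then 1 - t\<^sup>2 else 0)" for t
      by (simp add: h_def space_PiM)
    show ?thesis
    proof (cases "rest y \<le> b")
      case True
      define s where "s = sqrt ((b - rest y) / w k)"
      have s: "s \<ge> 0" "s\<^sup>2 = (b - rest y) / w k" using True w[of k] by (auto simp: s_def)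
      have "w k * t\<^sup>2 + rest y \<le> b \<longleftrightarrow> t \<in> {-s..s}" for t
      proof -
        have "w k * t\<^sup>2 + rest y \<le> b \<longleftrightarrow> t\<^sup>2 \<le> s\<^sup>2" using w[of k] by (simp add: s(2) field_simps)
        also have "\<dots> \<longleftrightarrow> t \<in> {-s..s}" using s(1) by (auto simp: abs_le_square_iff[symmetric])
        finally show ?thesis .
      qed
      then have "h (y(k := t)) = indicator {-s..s} t * (1 - t\<^sup>2)" for t
        by (simp add: hy)
      then show ?thesis using True s(1) by (simp add: integral_std_normal_truncated g_def s_def[symmetric])
    next
      case False
      have "h (y(k := t)) = 0" for t
        using False mult_nonneg_nonneg[OF less_imp_le[OF w[of k]] zero_le_power2[of t]] by (simp add: hy)
      then show ?thesis using False by (simp add: g_def)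
    qed
  qed
  have g0: "g y \<ge> 0" for y using w[of k] by (simp add: g_def Let_def)
  \<comment> \<open>Where \<open>rest y = b\<close> the section is a single point and
    \<open>g\<close> is 0, hence the strict inequality.\<close>
  have gpos: "g y > 0" if "rest y < b" for y
    using that w[of k] by (simp add: g_def Let_def normal_density_pos)
  have hi': "integrable (PiM (insert k I) (\<lambda>_. std_normal)) h" using hi I by simp
  have hg: "(\<integral>z. h z \<partial>std_normal_vec) = (\<integral>y. g y \<partial>PiM I (\<lambda>_. std_normal))"
    using std_normal_product.product_integral_insert[OF I(1,2) hi'] by (simp add: I(3) g)
  \<comment> \<open>Integrability is what allows concluding \<open>g = 0\<close> almost everywhere
    from a zero integral. The bound combines \<open>s <= sqrt (b / w k)\<close> with a normal
    density of at most 1.\<close>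
  have gi: "integrable (PiM I (\<lambda>_. std_normal)) g"
  proof (rule std_normal_product.integrable_const_bound[where B = "2 * sqrt (b / w k)"])
    have [measurable]: "rest \<in> borel_measurable (PiM I (\<lambda>_. std_normal))"
      using I(1) unfolding rest_def by measurable
    show "g \<in> borel_measurable (PiM I (\<lambda>_. std_normal))"
      unfolding g_def Let_def by measurable
    have "g y \<le> 2 * sqrt (b / w k)" for y
    proof (cases "rest y \<le> b")
      case True
      have "rest y \<ge> 0" unfolding rest_def by (intro sum_nonneg mult_nonneg_nonneg less_imp_le[OF w]) simp
      then have 1: "sqrt ((b - rest y) / w k) \<le> sqrt (b / w k)"
        using w[of k] by (intro real_sqrt_le_mono divide_right_mono) auto
      have "sqrt (2 * pi) \<ge> 1" using pi_gt3 by simp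
      then have 2: "std_normal_density t \<le> 1" for t
        unfolding std_normal_density_def by (intro mult_le_one) auto
      have "sqrt ((b - rest y) / w k) * std_normal_density (sqrt ((b - rest y) / w k)) \<le> sqrt (b / w k) * 1"
        using True w[of k] b by (intro mult_mono 1 2) auto
      then show ?thesis using True by (simp add: g_def Let_def)
    next
      case False
      then show ?thesis using w[of k] b by (simp add: g_def)
    qed
    then show "AE y in PiM I (\<lambda>_. std_normal). norm (g y) \<le> 2 * sqrt (b / w k)"
      using g0 by simp
  qed
  have "(\<integral>z. h z \<partial>std_normal_vec) \<noteq> 0"
  proof
    assume "(\<integral>z. h z \<partial>std_normal_vec) = 0"
    then have "AE y in PiM I (\<lambda>_. std_normal). g y = 0"
      using gi g0 by (simp add: hg integral_nonneg_eq_0_iff_AE)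
    then have "AE y in PiM I (\<lambda>_. std_normal). \<not> rest y < b"
      by eventually_elim (use gpos in force)
    moreover have "{y \<in> space (PiM I (\<lambda>_. std_normal)). rest y < b} \<in> sets (PiM I (\<lambda>_. std_normal))"
      using I(1) unfolding rest_def by measurable
    ultimately have "emeasure (PiM I (\<lambda>_. std_normal)) {y \<in> space (PiM I (\<lambda>_. std_normal)). rest y < b} = 0"
      by (subst (asm) AE_iff_measurable[OF _ refl]) auto
    then show False
      using emeasure_std_normal_quadratic_pos[of I w b] I(1) w b by (simp add: rest_def less_imp_le)
  qed
  moreover have "(\<integral>z. h z \<partial>std_normal_vec) \<ge> 0"
    unfolding hg by (intro integral_nonneg_AE) (simp add: g0)
  moreover have "(\<integral>z. h z \<partial>std_normal_vec) = measure std_normal_vec ?A - (\<integral>z. indicator ?A z * (z k)\<^sup>2 \<partial>std_normal_vec)"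
    using i1 i2 by (simp add: h_def right_diff_distrib)
  ultimately show ?thesis by simp
qed

section \<open>Integrals over sets invariant under sign changes\<close>

lemma integrable_std_normal_vec_mult:
  "integrable std_normal_vec (\<lambda>z :: 'k::finite \<Rightarrow> real. z i * z j)"
proof (rule Bochner_Integration.integrable_bound)
  show "integrable std_normal_vec (\<lambda>z :: 'k \<Rightarrow> real. (z i)\<^sup>2 + (z j)\<^sup>2)"
    by (intro Bochner_Integration.integrable_add integrable_std_normal_vec_square)
  show "AE z in std_normal_vec. norm (z i * z j) \<le> norm ((z i)\<^sup>2 + (z j)\<^sup>2)" for i j :: 'k
  proof (rule AE_I2)
    fix z :: "'k \<Rightarrow> real"
    have "2 * (\<bar>z i\<bar> * \<bar>z j\<bar>) \<le> (z i)\<^sup>2 + (z j)\<^sup>2"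
      using zero_le_power2[of "\<bar>z i\<bar> - \<bar>z j\<bar>"] by (simp add: power2_diff)
    moreover have "0 \<le> \<bar>z i\<bar> * \<bar>z j\<bar>" by simp
    ultimately have "\<bar>z i\<bar> * \<bar>z j\<bar> \<le> (z i)\<^sup>2 + (z j)\<^sup>2" by linarith
    then show "norm (z i * z j) \<le> norm ((z i)\<^sup>2 + (z j)\<^sup>2)" by (simp add: abs_mult)
  qed
qed measurable

lemma integrable_std_normal_vec_component:
  "integrable std_normal_vec (\<lambda>z :: 'k::finite \<Rightarrow> real. z i)"
  using integrable_std_normal_vec_square[of i]
  by (rule std_normal_product.square_integrable_imp_integrable[rotated]) simp

text \<open>Stated for an arbitrary invariant set, so that \<open>UNIV\<close> yields the
  unconditional moments and the ellipsoids the conditional ones.\<close>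

lemma
  fixes B :: "('k::finite \<Rightarrow> real) set" and u :: "'k \<Rightarrow> real"
  assumes B[measurable]: "B \<in> sets std_normal_vec"
    and sym: "\<And>k z. z(k := - z k) \<in> B \<longleftrightarrow> z \<in> B"
  shows integral_std_normal_vec_linear_symmetric:
      "(\<integral>z. indicator B z * (\<Sum>k\<in>UNIV. u k * z k) \<partial>std_normal_vec) = 0"
    and integral_std_normal_vec_quadratic_symmetric:
      "(\<integral>z. indicator B z * (\<Sum>k\<in>UNIV. u k * z k)\<^sup>2 \<partial>std_normal_vec)
        = (\<Sum>k\<in>UNIV. (u k)\<^sup>2 * (\<integral>z. indicator B z * (z k)\<^sup>2 \<partial>std_normal_vec))"
proof -
  have ind: "indicator B (z(k := - z k)) = (indicator B z :: real)" for z k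
    by (simp add: indicator_def sym)
  have [simp]: "integrable std_normal_vec (\<lambda>z. indicator B z * z k)" for k
    using integrable_real_mult_indicator[OF B integrable_std_normal_vec_component[of k]] by (simp add: mult.commute)
  have [simp]: "integrable std_normal_vec (\<lambda>z. indicator B z * (z j * z k))" for j k
    using integrable_real_mult_indicator[OF B integrable_std_normal_vec_mult[of j k]] by (simp add: mult.commute)
  have lin: "(\<integral>z. indicator B z * z k \<partial>std_normal_vec) = 0" for k
    by (rule integral_std_normal_vec_odd[where k = k]) (simp_all add: ind)
  have quad: "(\<integral>z. indicator B z * (z j * z k) \<partial>std_normal_vec) = 0" if "j \<noteq> k" for j k
    by (rule integral_std_normal_vec_odd[where k = k]) (use that in \<open>auto simp: ind\<close>)
  have "(\<integral>z. indicator B z * (\<Sum>k\<in>UNIV. u k * z k) \<partial>std_normal_vec)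
      = (\<integral>z. (\<Sum>k\<in>UNIV. u k * (indicator B z * z k)) \<partial>std_normal_vec)"
    by (simp add: sum_distrib_left mult_ac)
  also have "\<dots> = 0"
    by (simp add: lin)
  finally show "(\<integral>z. indicator B z * (\<Sum>k\<in>UNIV. u k * z k) \<partial>std_normal_vec) = 0" .
  have "(\<integral>z. indicator B z * (\<Sum>k\<in>UNIV. u k * z k)\<^sup>2 \<partial>std_normal_vec)
      = (\<integral>z. (\<Sum>j\<in>UNIV. \<Sum>k\<in>UNIV. u j * u k * (indicator B z * (z j * z k))) \<partial>std_normal_vec)"
    by (simp add: power2_eq_square sum_product sum_distrib_left mult_ac)
  also have "\<dots> = (\<Sum>j\<in>UNIV. \<Sum>k\<in>UNIV. u j * u k * (\<integral>z. indicator B z * (z j * z k) \<partial>std_normal_vec))"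
    by simp
  also have "\<dots> = (\<Sum>j\<in>UNIV. \<Sum>k\<in>UNIV. if k = j then (u j)\<^sup>2 * (\<integral>z. indicator B z * (z j)\<^sup>2 \<partial>std_normal_vec) else 0)"
    by (intro sum.cong refl) (auto simp: quad power2_eq_square)
  also have "\<dots> = (\<Sum>j\<in>UNIV. (u j)\<^sup>2 * (\<integral>z. indicator B z * (z j)\<^sup>2 \<partial>std_normal_vec))"
    by simp
  finally show "(\<integral>z. indicator B z * (\<Sum>k\<in>UNIV. u k * z k)\<^sup>2 \<partial>std_normal_vec)
        = (\<Sum>k\<in>UNIV. (u k)\<^sup>2 * (\<integral>z. indicator B z * (z k)\<^sup>2 \<partial>std_normal_vec))" .
qed

text \<open>These facts select the branch of \<open>cond_expectation_le\<close>: the elementary one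
  for positive thresholds, the limit at threshold 0, where only the origin is left.\<close>

lemma
  fixes w :: "'k::finite \<Rightarrow> real"
  assumes w: "\<And>j. 0 < w j"
  shows measure_std_normal_vec_quadratic_pos:
      "0 < b \<Longrightarrow> 0 < measure std_normal_vec {z \<in> space std_normal_vec. (\<Sum>j\<in>UNIV. w j * (z j)\<^sup>2) \<le> b}"
    and measure_std_normal_vec_quadratic_null:
      "measure std_normal_vec {z \<in> space std_normal_vec. (\<Sum>j\<in>UNIV. w j * (z j)\<^sup>2) \<le> 0} = 0"
proof -
  assume b: "0 < b"
  have "0 < emeasure std_normal_vec {z \<in> space std_normal_vec. (\<Sum>j\<in>UNIV. w j * (z j)\<^sup>2) < b}"
    using emeasure_std_normal_quadratic_pos[of UNIV w b] w b by (simp add: less_imp_le)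
  also have "\<dots> \<le> emeasure std_normal_vec {z \<in> space std_normal_vec. (\<Sum>j\<in>UNIV. w j * (z j)\<^sup>2) \<le> b}"
    by (rule emeasure_mono) (auto, measurable)
  finally show "0 < measure std_normal_vec {z \<in> space std_normal_vec. (\<Sum>j\<in>UNIV. w j * (z j)\<^sup>2) \<le> b}"
    by (simp add: std_normal_product.emeasure_eq_measure)
next
  have "{z \<in> space std_normal_vec. (\<Sum>j\<in>UNIV. w j * (z j)\<^sup>2) \<le> 0} \<subseteq> PiE UNIV (\<lambda>_. {0})"
  proof
    fix z assume "z \<in> {z \<in> space std_normal_vec. (\<Sum>j\<in>UNIV. w j * (z j)\<^sup>2) \<le> 0}"
    moreover have nn: "0 \<le> w j * (z j)\<^sup>2" for j
      using less_imp_le[OF w] by simp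
    then have "0 \<le> (\<Sum>j\<in>UNIV. w j * (z j)\<^sup>2)" by (rule sum_nonneg)
    ultimately have "(\<Sum>j\<in>UNIV. w j * (z j)\<^sup>2) = 0" by simp
    then have "\<forall>j. w j * (z j)\<^sup>2 = 0"
      using nn by (subst (asm) sum_nonneg_eq_0_iff) auto
    then have "z j = 0" for j using w[of j] by (metis less_irrefl mult_eq_0_iff power_eq_0_iff)
    then show "z \<in> PiE UNIV (\<lambda>_. {0})" by (simp add: fun_eq_iff)
  qed
  then have "emeasure std_normal_vec {z \<in> space std_normal_vec. (\<Sum>j\<in>UNIV. w j * (z j)\<^sup>2) \<le> 0}
      \<le> emeasure std_normal_vec (PiE (UNIV::'k set) (\<lambda>_. {0}))"
    by (rule emeasure_mono) (rule sets_PiM_I_finite; simp)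
  also have "\<dots> = (\<Prod>j\<in>(UNIV::'k set). emeasure std_normal {0})"
    by (subst std_normal_product.emeasure_PiM) auto
  also have "emeasure std_normal {0} = 0"
    using AE_lborel_singleton[of "0::real"]
    by (subst emeasure_density) (auto simp: nn_integral_0_iff_AE elim!: eventually_mono)
  \<comment> \<open>The index type is nonempty, so the product has a factor 0.\<close>
  also have "(\<Prod>j\<in>(UNIV::'k set). 0 :: ennreal) = 0"
    by (simp add: zero_power)
  finally show "measure std_normal_vec {z \<in> space std_normal_vec. (\<Sum>j\<in>UNIV. w j * (z j)\<^sup>2) \<le> 0} = 0"
    by (simp add: std_normal_product.emeasure_eq_measure)
qed

subsection \<open>Second moments truncated to an ellipsoid\<close>

text \<open>The conditional second moment of Z_k given the ellipsoid. The threshold comes last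
  because this is used as a function of it, with a limit at 0.\<close>

definition truncated_moment :: "('k::finite \<Rightarrow> real) \<Rightarrow> 'k \<Rightarrow> real \<Rightarrow> real" where
  "truncated_moment w k b =
     (\<integral>z. indicator {z \<in> space std_normal_vec. (\<Sum>j\<in>UNIV. w j * (z j)\<^sup>2) \<le> b} z * (z k)\<^sup>2 \<partial>std_normal_vec)
     / measure std_normal_vec {z \<in> space std_normal_vec. (\<Sum>j\<in>UNIV. w j * (z j)\<^sup>2) \<le> b}"

lemma truncated_moment_less_1:
  assumes "\<And>j. 0 < w j" "0 < b"
  shows "truncated_moment w k b < 1"
  using truncated_second_moment_less[of w b k] measure_std_normal_vec_quadratic_pos[of w b] assms
  by (simp add: truncated_moment_def)

text \<open>On the ellipsoid the single term \<open>w k * (z k)^2\<close> is at most b, so the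
  moment lies between 0 and \<open>b / w k\<close>.\<close>

lemma truncated_moment_tendsto_0:
  fixes w :: "'k::finite \<Rightarrow> real"
  assumes w: "\<And>j. 0 < w j"
  shows "(truncated_moment w k \<longlongrightarrow> 0) (at_right 0)"
proof (rule tendsto_sandwich)
  let ?A = "\<lambda>b. {z \<in> space std_normal_vec. (\<Sum>j\<in>UNIV. w j * (z j)\<^sup>2) \<le> b}"
  show "\<forall>\<^sub>F b in at_right 0. 0 \<le> truncated_moment w k b"
    by (intro always_eventually allI) (simp add: truncated_moment_def)
  have "truncated_moment w k b \<le> b / w k" if b: "0 < b" for b
  proof -
    have "(\<integral>z. indicator (?A b) z * (z k)\<^sup>2 \<partial>std_normal_vec) \<le> (\<integral>z. indicator (?A b) z * (b / w k) \<partial>std_normal_vec)"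
    proof (rule integral_mono)
      show "integrable std_normal_vec (\<lambda>z. indicator (?A b) z * (z k)\<^sup>2)"
        using integrable_real_mult_indicator[OF _ integrable_std_normal_vec_square, of "?A b" k]
        by (simp add: mult.commute)
      show "integrable std_normal_vec (\<lambda>z. indicator (?A b) z * (b / w k))"
        by (intro integrable_mult_left) (simp add: integrable_indicator_iff std_normal_product.emeasure_eq_measure)
      fix z :: "'k \<Rightarrow> real"
      have "w k * (z k)\<^sup>2 \<le> (\<Sum>j\<in>UNIV. w j * (z j)\<^sup>2)"
        using less_imp_le[OF w] by (intro member_le_sum[where f = "\<lambda>j. w j * (z j)\<^sup>2"]) simp_all
      then show "indicator (?A b) z * (z k)\<^sup>2 \<le> indicator (?A b) z * (b / w k)"
        using w[of k] by (auto simp: indicator_def field_simps)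
    qed
    also have "\<dots> = b / w k * measure std_normal_vec (?A b)"
      by simp
    finally show ?thesis
      using measure_std_normal_vec_quadratic_pos[of w b] w b by (simp add: truncated_moment_def field_simps)
  qed
  then show "\<forall>\<^sub>F b in at_right 0. truncated_moment w k b \<le> b / w k"
    by (rule eventually_mono[OF eventually_at_right_less])
  show "((\<lambda>b. b / w k) \<longlongrightarrow> 0) (at_right 0)"
    using w[of k] by (auto intro!: tendsto_eq_intros)
qed simp

text \<open>The value 0 at \<open>a = 0\<close> is a limit along shrinking ellipsoids; that
  \<open>truncated_moment\<close> at 0 is also 0 is an accident of division by 0.\<close>

lemma d_coeff_eq:
  assumes "\<And>j. 0 < lam j" "0 \<le> l" "0 \<le> a"
  shows "d_coeff lam l a k = (if a = 0 then 0 else truncated_moment (\<lambda>j. lam j / (lam j + l)) k a)"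
  unfolding d_coeff_def
proof (rule cond_expectation_le_eqI)
  have w: "0 < lam j / (lam j + l)" for j using assms(1)[of j] assms(2) by simp
  show "0 < measure std_normal_vec {z \<in> space std_normal_vec. (\<Sum>j\<in>UNIV. lam j / (lam j + l) * (z j)\<^sup>2) \<le> b}"
    if "0 < b" for b
    using measure_std_normal_vec_quadratic_pos[of "\<lambda>j. lam j / (lam j + l)" b] w that by blast
  from this show "(\<integral>z. indicator {z \<in> space std_normal_vec. (\<Sum>j\<in>UNIV. lam j / (lam j + l) * (z j)\<^sup>2) \<le> b} z * (z k)\<^sup>2 \<partial>std_normal_vec)
      = truncated_moment (\<lambda>j. lam j / (lam j + l)) k b
        * measure std_normal_vec {z \<in> space std_normal_vec. (\<Sum>j\<in>UNIV. lam j / (lam j + l) * (z j)\<^sup>2) \<le> b}"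
    if "0 < b" for b
    unfolding truncated_moment_def by (rule nonzero_divide_eq_eq[THEN iffD1, OF less_imp_neq[symmetric], OF _ refl]) (fact that)
  show "measure std_normal_vec {z \<in> space std_normal_vec. (\<Sum>j\<in>UNIV. lam j / (lam j + l) * (z j)\<^sup>2) \<le> 0} = 0"
    using measure_std_normal_vec_quadratic_null[of "\<lambda>j. lam j / (lam j + l)"] w by blast
  show "(truncated_moment (\<lambda>j. lam j / (lam j + l)) k \<longlongrightarrow> (if a = 0 then 0 else truncated_moment (\<lambda>j. lam j / (lam j + l)) k a)) (at_right 0)"
    if "a = 0"
    using truncated_moment_tendsto_0[of "\<lambda>j. lam j / (lam j + l)"] w that by simp
qed (use assms std_normal_product.finite_measure_axioms in auto)

lemma d_coeff_less_1:
  assumes "\<And>j. 0 < lam j" "0 \<le> l" "0 \<le> a"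
  shows "d_coeff lam l a k < 1"
proof (cases "a = 0")
  case False
  have "0 < lam j / (lam j + l)" for j using assms(1)[of j] assms(2) by simp
  then show ?thesis
    using False assms by (simp add: d_coeff_eq truncated_moment_less_1)
qed (use assms in \<open>simp add: d_coeff_eq\<close>)

section \<open>Independence of variables of different types\<close>

text \<open>The real variables f(X) and g(Y) share a type, so they fall under
  \<open>indep_var\<close>, for which expectations of products factor.\<close>

lemma
  fixes f :: "'b::topological_space \<Rightarrow> real" and g :: "'c::topological_space \<Rightarrow> real"
  assumes M: "prob_space M" and indep: "indep_rv M X Y"
    and f: "f \<in> borel_measurable borel" and g: "g \<in> borel_measurable borel"
    and "integrable M (\<lambda>\<omega>. f (X \<omega>))" "integrable M (\<lambda>\<omega>. g (Y \<omega>))"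
  shows indep_rv_integrable_mult: "integrable M (\<lambda>\<omega>. f (X \<omega>) * g (Y \<omega>))"
    and indep_rv_integral_mult:
      "(\<integral>\<omega>. f (X \<omega>) * g (Y \<omega>) \<partial>M) = (\<integral>\<omega>. f (X \<omega>) \<partial>M) * (\<integral>\<omega>. g (Y \<omega>) \<partial>M)"
proof -
  interpret prob_space M by fact
  have m[measurable]: "X \<in> borel_measurable M" "Y \<in> borel_measurable M"
    and ind: "indep_set {X -` A \<inter> space M | A. A \<in> sets borel} {Y -` B \<inter> space M | B. B \<in> sets borel}"
    using indep by (auto simp: indep_rv_def)
  \<comment> \<open>A preimage under the composition of h with Z is a preimage under Z, and the
    latter already form a sigma algebra. Hence applying h only shrinks the generated events, and
    independence is inherited.\<close>
  have sub: "sigma_sets (space M) {(\<lambda>\<omega>. h (Z \<omega>)) -` A \<inter> space M | A. A \<in> sets borel}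
      \<subseteq> {Z -` B \<inter> space M | B. B \<in> sets borel}"
    if h: "h \<in> borel_measurable borel" for h :: "'d::topological_space \<Rightarrow> real" and Z
  proof -
    have "(\<lambda>\<omega>. h (Z \<omega>)) -` A \<inter> space M = Z -` (h -` A \<inter> space borel) \<inter> space M" for A by auto
    then have "{(\<lambda>\<omega>. h (Z \<omega>)) -` A \<inter> space M | A. A \<in> sets borel} \<subseteq> {Z -` B \<inter> space M | B. B \<in> sets borel}"
      using measurable_sets[OF h] by blast
    moreover have "space M \<in> sets (vimage_algebra (space M) Z borel)"
      using sets.top[of "vimage_algebra (space M) Z borel"] by simp
    ultimately have "sigma_sets (space M) {(\<lambda>\<omega>. h (Z \<omega>)) -` A \<inter> space M | A. A \<in> sets borel}
        \<subseteq> sets (vimage_algebra (space M) Z borel)"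
      by (intro sets.sigma_sets_subset') (simp_all add: sets_vimage_algebra2)
    then show ?thesis by (simp add: sets_vimage_algebra2)
  qed
  have "indep_var borel (\<lambda>\<omega>. f (X \<omega>)) borel (\<lambda>\<omega>. g (Y \<omega>))"
    unfolding indep_var_eq
  proof (intro conjI)
    show "random_variable borel (\<lambda>\<omega>. f (X \<omega>))" "random_variable borel (\<lambda>\<omega>. g (Y \<omega>))"
      using measurable_compose[OF m(1) f] measurable_compose[OF m(2) g] .
    show "indep_set (sigma_sets (space M) {(\<lambda>\<omega>. f (X \<omega>)) -` A \<inter> space M | A. A \<in> sets borel})
        (sigma_sets (space M) {(\<lambda>\<omega>. g (Y \<omega>)) -` A \<inter> space M | A. A \<in> sets borel})"
      using ind unfolding indep_set_def
      by (rule indep_sets_mono_sets) (use sub[OF f, of X] sub[OF g, of Y] in \<open>auto split: bool.split\<close>)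
  qed
  then show "integrable M (\<lambda>\<omega>. f (X \<omega>) * g (Y \<omega>))"
    "(\<integral>\<omega>. f (X \<omega>) * g (Y \<omega>) \<partial>M) = (\<integral>\<omega>. f (X \<omega>) \<partial>M) * (\<integral>\<omega>. g (Y \<omega>) \<partial>M)"
    using assms(5,6) by (auto intro: indep_var_integrable indep_var_lebesgue_integral)
qed

subsection \<open>Variance reduction\<close>

text \<open>The probabilistic core, detached from the experiment: \<open>t\<close> is a constant
  shift, \<beta> \<bullet> D the part that conditioning affects, and E the independent
  remainder.\<close>

lemma ridge_variance_reduction:
  fixes D :: "'a \<Rightarrow> real^'k" and E T :: "'a \<Rightarrow> real"
  assumes M: "prob_space M" and normal: "multivariate_normal M D 0 \<Sigma>"
    and G: "orthogonal_matrix G" and S: "\<Sigma> = G ** diag_matrix lam ** transpose G"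
    and lam: "\<And>k. 0 < lam k" and l: "0 \<le> l" and a: "0 \<le> a"
    and indep: "indep_rv M E D" and E2: "integrable M (\<lambda>\<omega>. (E \<omega>)\<^sup>2)"
    and T[measurable]: "T \<in> borel_measurable M"
    and T_eq: "AE \<omega> in M. T \<omega> = t + \<beta> \<bullet> D \<omega> + E \<omega>"
  shows "rvariance M T - cond_variance_le M (\<lambda>\<omega>. D \<omega> \<bullet> (matrix_inv (\<Sigma> + l *\<^sub>R mat 1) *v D \<omega>)) a T
    = (\<Sum>k\<in>UNIV. lam k * (1 - d_coeff lam l a k) * ((transpose G *v \<beta>) $ k)\<^sup>2)"
proof -
  interpret prob_space M by fact
  let ?P = "std_normal_vec :: ('k \<Rightarrow> real) measure"
  have [measurable]: "E \<in> borel_measurable M" "D \<in> borel_measurable M"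
    using indep by (auto simp: indep_rv_def)
  define L where "L = (\<lambda>z :: 'k \<Rightarrow> real. G *v (\<chi> k. sqrt (lam k) * z k))"
  \<comment> \<open>\<open>u k\<close> is the coefficient of Z_k in \<beta> \<bullet> D; its square
    supplies the factor \<open>lam k\<close> of the result.\<close>
  define u where "u = (\<lambda>k. (transpose G *v \<beta>) $ k * sqrt (lam k))"
  define w where "w = (\<lambda>k. lam k / (lam k + l))"
  define q where "q = (\<lambda>v. v \<bullet> (matrix_inv (\<Sigma> + l *\<^sub>R mat 1) *v v))"
  have w: "0 < w k" for k using lam[of k] l by (simp add: w_def)
  have GG: "transpose G ** G = mat 1" "G ** transpose G = mat 1" using G by (auto simp: orthogonal_matrix_def)
  have distr_D: "distr M borel D = distr ?P borel L"
    unfolding L_def by (rule distr_multivariate_normal[OF M normal G S lam])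
  have Lm[measurable]: "L \<in> borel_measurable ?P"
  proof -
    have v: "vec_lambda \<in> borel_measurable ?P" by (rule borel_measurable_vec_lambda) simp
    have "continuous_on UNIV (\<lambda>v. G *v (diag_matrix (\<lambda>k. sqrt (lam k)) *v v))"
      by (intro linear_continuous_on bounded_linear_compose[OF matrix_vector_mul_bounded_linear] matrix_vector_mul_bounded_linear)
    from measurable_compose[OF v borel_measurable_continuous_onI[OF this]] show ?thesis
      by (simp add: L_def diag_matrix_mult_vec)
  qed
  have \<beta>L: "\<beta> \<bullet> L z = (\<Sum>k\<in>UNIV. u k * z k)" for z
    unfolding L_def dot_lmul_matrix[symmetric] by (simp add: u_def inner_vec_def mult_ac)
  have GL: "transpose G *v L z = (\<chi> k. sqrt (lam k) * z k)" for z
    by (simp add: L_def matrix_vector_mul_assoc GG del: transpose_matrix_vector)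
  have S_l: "\<Sigma> + l *\<^sub>R mat 1 = G ** diag_matrix (\<lambda>k. lam k + l) ** transpose G"
  proof -
    have "diag_matrix (\<lambda>k. lam k + l) = diag_matrix lam + l *\<^sub>R mat 1"
      by (simp add: diag_matrix_def mat_def vec_eq_iff)
    moreover have "(X + Y) ** Z = X ** Z + Y ** Z" for X Y Z :: "real^'k^'k"
      by (simp add: matrix_matrix_mult_def vec_eq_iff distrib_right sum.distrib)
    moreover have "(l *\<^sub>R X) ** Z = l *\<^sub>R (X ** Z)" for X Z :: "real^'k^'k"
      by (rule scalar_matrix_assoc[symmetric])
    moreover have "X ** (l *\<^sub>R Z) = l *\<^sub>R (X ** Z)" for X Z :: "real^'k^'k"
      by (simp add: matrix_scalar_ac scalar_matrix_assoc)
    ultimately show ?thesis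
      by (simp add: S matrix_add_ldistrib GG)
  qed
  have lam_l: "lam k + l \<noteq> 0" for k using lam[of k] l by simp
  have qL: "q (L z) = (\<Sum>k\<in>UNIV. w k * (z k)\<^sup>2)" for z
    unfolding q_def S_l matrix_inv_spectral[OF G lam_l] inner_spectral GL
    using lam by (simp add: w_def power_mult_distrib less_imp_le)
  have qm[measurable]: "q \<in> borel_measurable borel"
    unfolding q_def by (intro borel_measurable_continuous_onI continuous_intros linear_continuous_on matrix_vector_mul_bounded_linear)

  have int_D: "(\<integral>\<omega>. f (D \<omega>) \<partial>M) = (\<integral>z. f (L z) \<partial>?P)"
    and intble_D: "integrable M (\<lambda>\<omega>. f (D \<omega>)) \<longleftrightarrow> integrable ?P (\<lambda>z. f (L z))"
    if [measurable]: "f \<in> borel_measurable borel" for f :: "real^'k \<Rightarrow> real"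
    using integral_distr[of D M borel f] integral_distr[of L ?P borel f]
      integrable_distr_eq[of D M borel f] integrable_distr_eq[of L ?P borel f] by (simp_all add: distr_D)
  define e where "e = (\<integral>\<omega>. E \<omega> \<partial>M)"
  define V where "V = (\<integral>\<omega>. (E \<omega> - e)\<^sup>2 \<partial>M)"
  have E1: "integrable M E"
    using E2 by (rule square_integrable_imp_integrable[rotated]) simp
  have Ee2: "integrable M (\<lambda>\<omega>. (E \<omega> - e)\<^sup>2)"
    using E1 E2 by (simp add: power2_diff)
  have Ee: "(\<integral>\<omega>. (E \<omega> - e) \<partial>M) = 0"
    using E1 by (simp add: e_def prob_space)

  \<comment> \<open>\<open>A\<close> is a set of values of D and \<open>B\<close> its pullback to
    the standard normal vector. With E centered at its mean \<open>e\<close>, the cross terms vanish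
    by independence, and E contributes only \<open>V\<close> times the probability of the
    event.\<close>
  have symmetric_event:
    "(\<integral>\<omega>. indicator A (D \<omega>) * T \<omega> \<partial>M) = (t + e) * measure ?P B"
    "(\<integral>\<omega>. indicator A (D \<omega>) * (T \<omega> - (t + e))\<^sup>2 \<partial>M)
      = (\<Sum>k\<in>UNIV. (u k)\<^sup>2 * (\<integral>z. indicator B z * (z k)\<^sup>2 \<partial>?P)) + V * measure ?P B"
    if A[measurable]: "A \<in> sets borel" and B: "B = L -` A"
      and sym: "\<And>k z. z(k := - z k) \<in> B \<longleftrightarrow> z \<in> B" for A B
  proof -
    have Bm[measurable]: "B \<in> sets ?P"
      using measurable_sets[OF Lm A] by (simp add: B space_PiM)
    have ind: "indicator A (L z) = indicator B z" for z by (simp add: B indicator_def)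
    have m: "(indicator A :: _ \<Rightarrow> real) \<in> borel_measurable borel" by simp
    have restrict: "integrable ?P (\<lambda>z. indicator B z * f z)" if "integrable ?P f" for f :: "_ \<Rightarrow> real"
      using integrable_real_mult_indicator[OF Bm that] by (simp only: mult.commute)
    have "integrable ?P (\<lambda>z. \<Sum>k\<in>UNIV. u k * z k)"
      by (simp add: integrable_std_normal_vec_component)
    then have i1: "integrable ?P (\<lambda>z. indicator B z * (\<Sum>k\<in>UNIV. u k * z k))"
      by (rule restrict)
    have "integrable ?P (\<lambda>z. \<Sum>j\<in>UNIV. \<Sum>k\<in>UNIV. u j * u k * (z j * z k))"
      by (simp add: integrable_std_normal_vec_mult)
    then have "integrable ?P (\<lambda>z. (\<Sum>k\<in>UNIV. u k * z k)\<^sup>2)"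
      by (simp add: power2_eq_square sum_product mult_ac)
    then have i2: "integrable ?P (\<lambda>z. indicator B z * (\<Sum>k\<in>UNIV. u k * z k)\<^sup>2)"
      by (rule restrict)
    have i0: "integrable ?P (indicator B :: _ \<Rightarrow> real)"
      by (simp add: integrable_indicator_iff std_normal_product.emeasure_eq_measure)
    have D0: "integrable M (\<lambda>\<omega>. indicator A (D \<omega>) :: real)" "(\<integral>\<omega>. indicator A (D \<omega>) \<partial>M) = measure ?P B"
      using i0 by (simp_all add: int_D[OF m] intble_D[OF m] ind space_PiM)
    have D1: "integrable M (\<lambda>\<omega>. indicator A (D \<omega>) * (\<beta> \<bullet> D \<omega>))" "(\<integral>\<omega>. indicator A (D \<omega>) * (\<beta> \<bullet> D \<omega>) \<partial>M) = 0"
      using i1 integral_std_normal_vec_linear_symmetric[OF Bm sym, of u]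
        int_D[of "\<lambda>v. indicator A v * (\<beta> \<bullet> v)"] intble_D[of "\<lambda>v. indicator A v * (\<beta> \<bullet> v)"]
      by (simp_all add: ind \<beta>L)
    have D2: "integrable M (\<lambda>\<omega>. indicator A (D \<omega>) * (\<beta> \<bullet> D \<omega>)\<^sup>2)"
      "(\<integral>\<omega>. indicator A (D \<omega>) * (\<beta> \<bullet> D \<omega>)\<^sup>2 \<partial>M) = (\<Sum>k\<in>UNIV. (u k)\<^sup>2 * (\<integral>z. indicator B z * (z k)\<^sup>2 \<partial>?P))"
      using i2 integral_std_normal_vec_quadratic_symmetric[OF Bm sym, of u]
        int_D[of "\<lambda>v. indicator A v * (\<beta> \<bullet> v)\<^sup>2"] intble_D[of "\<lambda>v. indicator A v * (\<beta> \<bullet> v)\<^sup>2"]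
      by (simp_all add: ind \<beta>L)
    have E0: "integrable M (\<lambda>\<omega>. (E \<omega> - e) * indicator A (D \<omega>))" "(\<integral>\<omega>. (E \<omega> - e) * indicator A (D \<omega>) \<partial>M) = 0"
      using indep_rv_integrable_mult[OF M indep, of "\<lambda>x. x - e" "indicator A"]
        indep_rv_integral_mult[OF M indep, of "\<lambda>x. x - e" "indicator A"] E1 D0 Ee by simp_all
    have E1': "integrable M (\<lambda>\<omega>. (E \<omega> - e) * (indicator A (D \<omega>) * (\<beta> \<bullet> D \<omega>)))"
      "(\<integral>\<omega>. (E \<omega> - e) * (indicator A (D \<omega>) * (\<beta> \<bullet> D \<omega>)) \<partial>M) = 0"
      using indep_rv_integrable_mult[OF M indep, of "\<lambda>x. x - e" "\<lambda>v. indicator A v * (\<beta> \<bullet> v)"]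
        indep_rv_integral_mult[OF M indep, of "\<lambda>x. x - e" "\<lambda>v. indicator A v * (\<beta> \<bullet> v)"] E1 D1 by simp_all
    have E2': "integrable M (\<lambda>\<omega>. (E \<omega> - e)\<^sup>2 * indicator A (D \<omega>))"
      "(\<integral>\<omega>. (E \<omega> - e)\<^sup>2 * indicator A (D \<omega>) \<partial>M) = V * measure ?P B"
      using indep_rv_integrable_mult[OF M indep, of "\<lambda>x. (x - e)\<^sup>2" "indicator A"]
        indep_rv_integral_mult[OF M indep, of "\<lambda>x. (x - e)\<^sup>2" "indicator A"] Ee2 D0 by (simp_all add: V_def)
    have "(\<integral>\<omega>. indicator A (D \<omega>) * T \<omega> \<partial>M)
        = (\<integral>\<omega>. (t + e) * indicator A (D \<omega>) + (indicator A (D \<omega>) * (\<beta> \<bullet> D \<omega>) + (E \<omega> - e) * indicator A (D \<omega>)) \<partial>M)"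
      by (rule integral_cong_AE, measurable) (use T_eq in \<open>eventually_elim, simp add: algebra_simps\<close>)
    also have "\<dots> = (t + e) * measure ?P B"
      using D0 D1 E0 by simp
    finally show "(\<integral>\<omega>. indicator A (D \<omega>) * T \<omega> \<partial>M) = (t + e) * measure ?P B" .
    have "(\<integral>\<omega>. indicator A (D \<omega>) * (T \<omega> - (t + e))\<^sup>2 \<partial>M)
        = (\<integral>\<omega>. indicator A (D \<omega>) * (\<beta> \<bullet> D \<omega>)\<^sup>2 + (2 * ((E \<omega> - e) * (indicator A (D \<omega>) * (\<beta> \<bullet> D \<omega>))) + (E \<omega> - e)\<^sup>2 * indicator A (D \<omega>)) \<partial>M)"
      by (rule integral_cong_AE, measurable) (use T_eq in \<open>eventually_elim, simp add: algebra_simps power2_eq_square\<close>)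
    also have "\<dots> = (\<Sum>k\<in>UNIV. (u k)\<^sup>2 * (\<integral>z. indicator B z * (z k)\<^sup>2 \<partial>?P)) + V * measure ?P B"
      using D2 E1' E2' by simp
    finally show "(\<integral>\<omega>. indicator A (D \<omega>) * (T \<omega> - (t + e))\<^sup>2 \<partial>M)
        = (\<Sum>k\<in>UNIV. (u k)\<^sup>2 * (\<integral>z. indicator B z * (z k)\<^sup>2 \<partial>?P)) + V * measure ?P B" .
  qed

  \<comment> \<open>The event \<open>UNIV\<close> gives the mean \<open>t + e\<close> and, as every
    Z_k has second moment 1, the sum of the squares of \<open>u\<close>.\<close>
  have rvar: "rvariance M T = (\<Sum>k\<in>UNIV. (u k)\<^sup>2) + V"
    using symmetric_event[of UNIV UNIV] prob_space.prob_space[OF prob_space_PiM[OF prob_space_std_normal], of "UNIV :: 'k set"]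
    by (simp add: rvariance_def integral_std_normal_vec_square space_PiM)

  define A where "A = (\<lambda>b. {v. q v \<le> b})"
  define B where "B = (\<lambda>b. {z \<in> space ?P. (\<Sum>k\<in>UNIV. w k * (z k)\<^sup>2) \<le> b})"
  have A[measurable]: "A b \<in> sets borel" for b unfolding A_def by measurable
  have B: "B b = L -` A b" for b by (auto simp: A_def B_def qL space_PiM)
  have sym: "z(k := - z k) \<in> B b \<longleftrightarrow> z \<in> B b" for z k b
  proof -
    have "(\<Sum>j\<in>UNIV. w j * ((z(k := - z k)) j)\<^sup>2) = (\<Sum>j\<in>UNIV. w j * (z j)\<^sup>2)"
      by (intro sum.cong) auto
    then show ?thesis by (simp add: B_def space_PiM)
  qed
  have meas: "measure M {\<omega> \<in> space M. q (D \<omega>) \<le> b} = measure ?P (B b)" for b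
  proof -
    have "measure M {\<omega> \<in> space M. q (D \<omega>) \<le> b} = measure (distr M borel D) (A b)"
      by (subst measure_distr) (auto simp: A_def intro!: arg_cong2[where f = measure])
    also have "\<dots> = measure ?P (B b)"
      unfolding distr_D by (subst measure_distr) (auto simp: B space_PiM)
    finally show ?thesis .
  qed
  have indA: "(\<integral>\<omega>. indicator {\<omega> \<in> space M. q (D \<omega>) \<le> b} \<omega> * X \<omega> \<partial>M) = (\<integral>\<omega>. indicator (A b) (D \<omega>) * X \<omega> \<partial>M)" for b X
    by (intro Bochner_Integration.integral_cong) (auto simp: A_def indicator_def)
  have pos: "0 < measure M {\<omega> \<in> space M. q (D \<omega>) \<le> b}" if "0 < b" for b
    unfolding meas using measure_std_normal_vec_quadratic_pos[of w b] w that by (simp add: B_def)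
  have null: "measure M {\<omega> \<in> space M. q (D \<omega>) \<le> 0} = 0"
    unfolding meas using measure_std_normal_vec_quadratic_null[of w] w by (simp add: B_def)
  have qD[measurable]: "(\<lambda>\<omega>. q (D \<omega>)) \<in> borel_measurable M" by measurable

  \<comment> \<open>Here the ratio is constant in the threshold, so the mean is \<open>t + e\<close>
    also in the limit case \<open>a = 0\<close>.\<close>
  have mean: "cond_expectation_le M (\<lambda>\<omega>. q (D \<omega>)) a T = t + e"
    by (rule cond_expectation_le_eqI[where r = "\<lambda>_. t + e"])
       (use pos null a symmetric_event(1)[OF A B sym] finite_measure_axioms in \<open>auto simp: indA meas\<close>)
  \<comment> \<open>The conditional variance as a function of the threshold; as it tends to 0 only
    \<open>V\<close> remains.\<close>
  define r where "r = (\<lambda>b. (\<Sum>k\<in>UNIV. (u k)\<^sup>2 * truncated_moment w k b) + V)"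
  have "cond_variance_le M (\<lambda>\<omega>. q (D \<omega>)) a T = (\<Sum>k\<in>UNIV. (u k)\<^sup>2 * d_coeff lam l a k) + V"
    unfolding cond_variance_le_def mean
  proof (rule cond_expectation_le_eqI[where r = r])
    fix b :: real assume b: "0 < b"
    have p: "0 < measure ?P (B b)" using pos[OF b] by (simp add: meas)
    have "r b * measure ?P (B b) = (\<Sum>k\<in>UNIV. (u k)\<^sup>2 * (truncated_moment w k b * measure ?P (B b))) + V * measure ?P (B b)"
      by (simp add: r_def distrib_right sum_distrib_right mult.assoc)
    moreover have "truncated_moment w k b * measure ?P (B b) = (\<integral>z. indicator (B b) z * (z k)\<^sup>2 \<partial>?P)" for k
      using p by (simp add: truncated_moment_def B_def)
    ultimately show "(\<integral>\<omega>. indicator {\<omega> \<in> space M. q (D \<omega>) \<le> b} \<omega> * (T \<omega> - (t + e))\<^sup>2 \<partial>M)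
      = r b * measure M {\<omega> \<in> space M. q (D \<omega>) \<le> b}"
      by (simp add: indA meas symmetric_event(2)[OF A B sym])
  next
    show "(r \<longlongrightarrow> (\<Sum>k\<in>UNIV. (u k)\<^sup>2 * d_coeff lam l a k) + V) (at_right 0)" if "a = 0"
      unfolding r_def using lam l that
      by (auto simp: d_coeff_eq intro!: tendsto_eq_intros truncated_moment_tendsto_0 w)
  next
    show "r a = (\<Sum>k\<in>UNIV. (u k)\<^sup>2 * d_coeff lam l a k) + V" if "0 < a"
      using lam l that by (simp add: r_def d_coeff_eq w_def)
  qed (use pos null a finite_measure_axioms in auto)
  then have "rvariance M T - cond_variance_le M (\<lambda>\<omega>. q (D \<omega>)) a T = (\<Sum>k\<in>UNIV. (u k)\<^sup>2 * (1 - d_coeff lam l a k))"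
    by (simp add: rvar right_diff_distrib sum_subtractf)
  also have "\<dots> = (\<Sum>k\<in>UNIV. lam k * (1 - d_coeff lam l a k) * ((transpose G *v \<beta>) $ k)\<^sup>2)"
    using lam by (intro sum.cong) (simp_all add: u_def power_mult_distrib less_imp_le mult_ac)
  finally show ?thesis by (simp add: q_def)
qed

section \<open>Application to the experiment\<close>

text \<open>The entries of w and of 1 - w sum to \<open>NT\<close> and \<open>NC\<close>. Hence the
  intercept \<open>\<beta>\<^sub>0\<close> cancels between the arm means, while \<tau>, present in
  the treated arm only, survives with coefficient 1.\<close>

lemma tau_hat_decomposition:
  fixes w :: "real^'n" and x :: "real^'k^'n"
  assumes sizes: "NT + NC = CARD('n)" "0 < NT" "0 < NC"
    and w: "(\<Sum>i\<in>UNIV. w $ i) = real NT"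
    and Y0: "\<And>i. Y0 $ i = \<beta>\<^sub>0 + x $ i \<bullet> \<beta> + \<epsilon> $ i"
    and Y1: "\<And>i. Y1 $ i = Y0 $ i + \<tau>"
  shows "tau_hat NT NC Y1 Y0 w
    = \<tau> + \<beta> \<bullet> (xbar_T NT x w - xbar_C NC x w) + (mean_T NT \<epsilon> w - mean_C NC \<epsilon> w)"
proof -
  have Y0': "Y0 = \<beta>\<^sub>0 *\<^sub>R 1 + x *v \<beta> + \<epsilon>"
    by (simp add: vec_eq_iff Y0 matrix_vector_mul_component)
  have Y1': "Y1 = Y0 + \<tau> *\<^sub>R 1"
    by (simp add: vec_eq_iff Y1)
  have w1: "w \<bullet> 1 = real NT" using w by (simp add: inner_vec_def)
  have "(1 :: real^'n) \<bullet> 1 = real CARD('n)" by (simp add: inner_vec_def)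
  then have w2: "(1 - w) \<bullet> 1 = real NC"
    using w1 by (simp add: inner_diff_left flip: sizes(1))
  have "\<beta> \<bullet> (transpose x *v v) = v \<bullet> (x *v \<beta>)" for v
    by (simp add: dot_lmul_matrix[symmetric] inner_commute)
  then have "\<beta> \<bullet> (xbar_T NT x w - xbar_C NC x w) = (w \<bullet> (x *v \<beta>)) / real NT - ((1 - w) \<bullet> (x *v \<beta>)) / real NC"
    by (simp add: xbar_T_def xbar_C_def inner_diff_right del: transpose_matrix_vector)
  moreover have "tau_hat NT NC Y1 Y0 w
      = (w \<bullet> (x *v \<beta>) + w \<bullet> \<epsilon> + (\<beta>\<^sub>0 + \<tau>) * real NT) / real NT
        - ((1 - w) \<bullet> (x *v \<beta>) + (1 - w) \<bullet> \<epsilon> + \<beta>\<^sub>0 * real NC) / real NC"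
    unfolding tau_hat_def mean_T_def mean_C_def Y1' Y0' inner_add_right inner_scaleR_right w1 w2
    by (simp add: algebra_simps)
  ultimately show ?thesis
    using sizes by (simp add: mean_T_def mean_C_def add_divide_distrib)
qed

text \<open>The mean difference is affine in W \<bullet> \<epsilon>, which is square integrable by
  Cauchy-Schwarz because the entries of W are.\<close>

lemma random_assignment_square_integrable:
  fixes W :: "'a \<Rightarrow> real^'n"
  assumes W: "random_assignment M NT W"
  shows "integrable M (\<lambda>\<omega>. (mean_T NT \<epsilon> (W \<omega>) - mean_C NC \<epsilon> (W \<omega>))\<^sup>2)"
proof -
  interpret prob_space M using W by (simp add: random_assignment_def)
  have [measurable]: "W \<in> borel_measurable M" and W2: "integrable M (\<lambda>\<omega>. (W \<omega> $ i)\<^sup>2)" for i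
    using W by (auto simp: random_assignment_def)
  have 2: "integrable M (\<lambda>\<omega>. (W \<omega> \<bullet> \<epsilon>)\<^sup>2)"
  proof (rule Bochner_Integration.integrable_bound)
    show "integrable M (\<lambda>\<omega>. (W \<omega> \<bullet> W \<omega>) * (\<epsilon> \<bullet> \<epsilon>))"
      using W2 by (auto simp: inner_vec_def[of "W _" "W _"] simp flip: power2_eq_square)
    show "AE \<omega> in M. norm ((W \<omega> \<bullet> \<epsilon>)\<^sup>2) \<le> norm ((W \<omega> \<bullet> W \<omega>) * (\<epsilon> \<bullet> \<epsilon>))"
      by (simp add: Cauchy_Schwarz_ineq)
  qed measurable
  then have 1: "integrable M (\<lambda>\<omega>. W \<omega> \<bullet> \<epsilon>)"
    by (rule square_integrable_imp_integrable[rotated]) measurable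
  \<comment> \<open>Expanding the control mean over 1 - W gives the mean difference as
    \<open>c\<close> times W \<bullet> \<epsilon> minus \<open>d\<close>.\<close>
  define c d where "c = 1 / real NT + 1 / real NC" and "d = (1 \<bullet> \<epsilon>) / real NC"
  have "integrable M (\<lambda>\<omega>. (c * (W \<omega> \<bullet> \<epsilon>) - d)\<^sup>2)"
    using 1 2 by (simp add: power2_diff power_mult_distrib)
  then show ?thesis
    by (simp add: mean_T_def mean_C_def c_def d_def inner_diff_left diff_divide_distrib algebra_simps)
qed

theorem theorem4p3:
  fixes M :: "'a measure"
    and W :: "'a \<Rightarrow> real^'n"
    and x :: "real^('k::{finite,linorder})^'n"
    and \<Gamma> :: "real^('k::{finite,linorder})^('k::{finite,linorder})"
    and lam :: "'k::{finite,linorder} \<Rightarrow> real"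
    and Y1 Y0 \<epsilon> :: "real^'n"
    and \<beta>\<^sub>0 l a \<tau> :: real
    and \<beta> :: "real^('k::{finite,linorder})"
    and NT NC :: nat
  defines "\<Sigma> \<equiv> cov_mean_diff NT NC x"
    and "\<tau> \<equiv> average_treatment_effect Y1 Y0"
    and "D \<equiv> (\<lambda>\<omega>. xbar_T NT x (W \<omega>) - xbar_C NC x (W \<omega>))"
    and "E \<equiv> (\<lambda>\<omega>. mean_T NT \<epsilon> (W \<omega>) - mean_C NC \<epsilon> (W \<omega>))"
    and "T \<equiv> (\<lambda>\<omega>. tau_hat NT NC Y1 Y0 (W \<omega>))"
    and "M\<^sub>l \<equiv> (\<lambda>\<omega>. ridge_mahalanobis NT NC x l (W \<omega>))"
  assumes sizes: "NT + NC = CARD('n)" "0 < NT" "0 < NC"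
    and assignment: "random_assignment M NT W"
    and posdef: "positive_definite \<Sigma>"
    and spectral: "orthogonal_matrix \<Gamma>" "\<Sigma> = \<Gamma> ** diag_matrix lam ** transpose \<Gamma>"
      "antimono lam" "\<And>k. 0 < lam k"
    and additive: "\<And>i. Y1 $ i = Y0 $ i + \<tau>"
    and projection:
      "is_projection_onto (span (insert 1 (columns x))) Y0 (\<beta>\<^sub>0 *\<^sub>R 1 + x *v \<beta>)"
    and outcome0: "\<And>i. Y0 $ i = \<beta>\<^sub>0 + x $ i \<bullet> \<beta> + \<epsilon> $ i"
    and outcome1: "\<And>i. Y1 $ i = \<beta>\<^sub>0 + x $ i \<bullet> \<beta> + \<tau> + \<epsilon> $ i"
    and constants: "0 \<le> l" "0 \<le> a"
    and normal: "multivariate_normal M D 0 \<Sigma>"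
    and balanced: "NT = NC"
    and indep: "indep_rv M E D"
  shows "rvariance M T - cond_variance_le M M\<^sub>l a T
           = \<beta> \<bullet> ((\<Gamma> ** diag_matrix (\<lambda>k. lam k * (1 - d_coeff lam l a k)) ** transpose \<Gamma>) *v \<beta>)
         \<and> cond_variance_le M M\<^sub>l a T \<le> rvariance M T
         \<and> (cond_variance_le M M\<^sub>l a T = rvariance M T \<longleftrightarrow> \<beta> = 0)"
proof -
  have M: "prob_space M" and [measurable]: "W \<in> borel_measurable M"
    and W_sum: "AE \<omega> in M. (\<Sum>i\<in>UNIV. W \<omega> $ i) = real NT"
    using assignment by (auto simp: random_assignment_def)
  \<comment> \<open>The coordinates of \<beta> in the eigenvector basis, where the variance
    reduction is diagonal.\<close>
  define b where "b = transpose \<Gamma> *v \<beta>"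
  have T_eq: "AE \<omega> in M. T \<omega> = \<tau> + \<beta> \<bullet> D \<omega> + E \<omega>"
    using W_sum
  proof eventually_elim
    case (elim \<omega>)
    show ?case
      unfolding T_def D_def E_def
      by (rule tau_hat_decomposition[OF sizes elim outcome0 additive])
  qed
  have T: "T \<in> borel_measurable M"
    unfolding T_def tau_hat_def mean_T_def mean_C_def by measurable
  have E2: "integrable M (\<lambda>\<omega>. (E \<omega>)\<^sup>2)"
    unfolding E_def by (rule random_assignment_square_integrable[OF assignment])
  have "M\<^sub>l = (\<lambda>\<omega>. D \<omega> \<bullet> (matrix_inv (\<Sigma> + l *\<^sub>R mat 1) *v D \<omega>))"
    by (simp add: M\<^sub>l_def D_def \<Sigma>_def ridge_mahalanobis_def Let_def)
  then have diff: "rvariance M T - cond_variance_le M M\<^sub>l a T = (\<Sum>k\<in>UNIV. lam k * (1 - d_coeff lam l a k) * (b $ k)\<^sup>2)"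
    using ridge_variance_reduction[OF M normal spectral(1,2,4) constants indep E2 T T_eq] by (simp only: b_def)
  \<comment> \<open>Strict positivity for every k is what the equality case rests on: a zero sum of
    nonnegative terms then forces each coordinate of \<open>b\<close> to vanish.\<close>
  have coeff: "0 < lam k * (1 - d_coeff lam l a k)" for k
    using spectral(4)[of k] d_coeff_less_1[of lam l a k] spectral(4) constants by simp
  then have nonneg: "0 \<le> lam k * (1 - d_coeff lam l a k) * (b $ k)\<^sup>2" for k
    by (intro mult_nonneg_nonneg less_imp_le[OF coeff]) simp
  have "cond_variance_le M M\<^sub>l a T = rvariance M T \<longleftrightarrow> (\<Sum>k\<in>UNIV. lam k * (1 - d_coeff lam l a k) * (b $ k)\<^sup>2) = 0"
    using diff by linarith
  also have "\<dots> \<longleftrightarrow> (\<forall>k. lam k * (1 - d_coeff lam l a k) * (b $ k)\<^sup>2 = 0)"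
    using nonneg by (subst sum_nonneg_eq_0_iff) auto
  also have "\<dots> \<longleftrightarrow> b = 0"
    unfolding mult_eq_0_iff[of "_ * _"] using less_imp_neq[OF coeff, symmetric]
    by (simp only: vec_eq_iff power_eq_0_iff zero_index) simp
  also have "\<dots> \<longleftrightarrow> \<beta> = 0"
  proof
    assume "b = 0"
    moreover have "\<Gamma> *v b = \<beta>"
      using spectral(1) by (simp add: b_def matrix_vector_mul_assoc orthogonal_matrix_def del: transpose_matrix_vector)
    ultimately show "\<beta> = 0" by simp
  qed (simp add: b_def)
  finally have "cond_variance_le M M\<^sub>l a T = rvariance M T \<longleftrightarrow> \<beta> = 0" .
  moreover have "cond_variance_le M M\<^sub>l a T \<le> rvariance M T"
    using diff sum_nonneg[of UNIV "\<lambda>k. lam k * (1 - d_coeff lam l a k) * (b $ k)\<^sup>2"] nonneg by simp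
  moreover have "rvariance M T - cond_variance_le M M\<^sub>l a T
      = \<beta> \<bullet> ((\<Gamma> ** diag_matrix (\<lambda>k. lam k * (1 - d_coeff lam l a k)) ** transpose \<Gamma>) *v \<beta>)"
    unfolding diff inner_spectral b_def ..
  ultimately show ?thesis by blast
qed

end
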